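(* Let $n=2m$ run through the even integers $n\ge 8$, put $N=n-1$, and let $\eta_j^{(n)}$ ($0\le j\le m-1$) be the central angular deficits along the marked half-cycle of the unique maximum-area small $n$-gon. Then, as $n\to\infty$, uniformly for $0\le j\le m-1$ (implied constants independent of $n$ and $j$), $$\eta_j^{(n)}=\frac{\pi w_j^*}{N+M_*}+O\left(n^{-3}+\frac{2^{-n/2}}{n}\right).$$ Consequently, $$\eta_j^{(n)}-\frac{\pi}{N+M_*}=\frac{\pi c_*}{N+M_*}\lambda_s^j+O\left(\frac{|\lambda_s|^{2j}}{n}+n^{-3}+\frac{2^{-n/2}}{n}\right).$$
   Context: A planar polygon is small if the distance between any two of its vertices is at most one. Structure of the maximizer (known input): for every even $n\ge 8$ there is exactly one congruence class (modulo reflection) of small $n$-gons of maximum area. With $N=n-1$, its unit-distance graph on the vertices consists of an $N$-cycle together with one pendant edge (the pendant diameter). Index the cycle vertices by $i\in\mathbb Z/N\mathbb Z$ so that vertices $i,i+1$ are at distance one and the marked vertex, where the pendant diameter is attached, has index $0$. For $i\ne0$ let $\gamma_i$ be the angle at vertex $i$ between the two unit segments to vertices $i-1$ and $i+1$; let $2\theta$ be the corresponding angle at vertex $0$. There are a point (the Noether center, taken as origin) and a scalar $C$ such that, with $z_i\in\mathbb R^2$ the vector from the center to vertex $i$ and $u_i=|z_i|^2$, $$u_i+C=\tfrac12\cos\gamma_i\ (i\ne0),\qquad u_0+C=\tfrac12\cos\theta .$$ The triangles $(0,z_i,z_{i+1})$ are nondegenerate, positive and consistently oriented, with unit base; let $\delta_i$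 be the angle at $0$ and let $\alpha_i,\beta_i$ be the angles at $z_i$ and $z_{i+1}$. One has $\gamma_i=\beta_{i-1}+\alpha_i$ ($i\neq 0$), $2\theta=\beta_{N-1}+\alpha_0$. The central deficit of edge $i=(i,i+1)$ is $\eta_i^{(n)}=\pi-\delta_i=\alpha_i+\beta_i$, and $\sum_{i=0}^{N-1}\eta_i^{(n)}=\pi$. The configuration is symmetric under the reflection $i\mapsto -i$ of vertices, i.e. $j\mapsto -j-1$ of edges; the marked half-cycle consists of the edges $0\le j\le m-1$. Limiting orbit: $w^*=(w_j^* )_{j\ge0}$ is the unique positive sequence with $3(w_0^* )^2+(w_0^*+w_1^* )^2=10$, $(w_{j-1}^*+w_j^* )^2+(w_j^*+w_{j+1}^* )^2+2(w_j^* )^2=10$ for $j\ge1$, and $w_j^*\to1$. Further $\lambda_s=\frac{-3+\sqrt5}{2}$, $c_*\ne0$ is the constant with $w_j^*-1=c_*\lambda_s^j+O(|\lambda_s|^{2j})$, and $M_*=2\sum_{j\ge0}(w_j^*-1)$. *)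

theory Defs
  imports "HOL-Analysis.Analysis" "HOL-Library.Landau_Symbols"
begin

text \<open>The plane is modelled by \<^typ>\<open>complex\<close>. A polygon with \<open>n\<close> vertices is given by its
  vertices \<open>p 0, \<dots>, p (n - 1)\<close> in boundary order.\<close>

definition polygon_side :: "nat \<Rightarrow> (nat \<Rightarrow> complex) \<Rightarrow> nat \<Rightarrow> complex set" where
  "polygon_side n p i = closed_segment (p i) (p (Suc i mod n))"

definition simple_polygon :: "nat \<Rightarrow> (nat \<Rightarrow> complex) \<Rightarrow> bool" where
  "simple_polygon n p \<longleftrightarrow> n \<ge> 3 \<and> inj_on p {..<n} \<and>
     (\<forall>i<n. \<forall>j<n. i \<noteq> j \<longrightarrow>
        polygon_side n p i \<inter> polygon_side n p j
          \<subseteq> {p i, p (Suc i mod n)} \<inter> {p j, p (Suc j mod n)})"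

definition polygon_area :: "nat \<Rightarrow> (nat \<Rightarrow> complex) \<Rightarrow> real" where
  "polygon_area n p = measure lebesgue (inside (\<Union>i<n. polygon_side n p i))"

definition small_polygon :: "nat \<Rightarrow> (nat \<Rightarrow> complex) \<Rightarrow> bool" where
  "small_polygon n p \<longleftrightarrow> simple_polygon n p \<and> (\<forall>i<n. \<forall>j<n. dist (p i) (p j) \<le> 1)"

definition max_area_small_polygon :: "nat \<Rightarrow> (nat \<Rightarrow> complex) \<Rightarrow> bool" where
  "max_area_small_polygon n p \<longleftrightarrow> small_polygon n p \<and>
     (\<forall>p'. small_polygon n p' \<longrightarrow> polygon_area n p' \<le> polygon_area n p)"

definition angle_at :: "complex \<Rightarrow> complex \<Rightarrow> complex \<Rightarrow> real" where
  "angle_at x y z = arccos (((x - y) \<bullet> (z - y)) / (norm (x - y) * norm (z - y)))"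

text \<open>Indices in \<open>\<int>/N\<int>\<close> are represented by \<open>N\<close>-periodic functions on the integers. The
  labelling \<open>v\<close> follows the cycle of unit distances, not the boundary of the polygon; \<open>q\<close> is
  the remaining vertex, the free end of the pendant diameter attached to \<open>v 0\<close>.\<close>

definition diameter_labelling :: "nat \<Rightarrow> complex set \<Rightarrow> (int \<Rightarrow> complex) \<Rightarrow> complex \<Rightarrow> bool" where
  "diameter_labelling N V v q \<longleftrightarrow>
     (\<forall>i. v (i + int N) = v i) \<and> inj_on v {0..<int N} \<and>
     q \<notin> range v \<and> V = insert q (range v) \<and>
     (\<forall>x\<in>V. \<forall>y\<in>V. dist x y = 1 \<longleftrightarrow>
        (\<exists>i. {x, y} = {v i, v (i + 1)}) \<or> {x, y} = {v 0, q})"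

text \<open>\<open>cycle_angle v i\<close> is \<open>\<gamma>\<^sub>i\<close> for \<open>i \<noteq> 0\<close> in \<open>\<int>/N\<int>\<close>, and \<open>2 * \<theta>\<close> for \<open>i = 0\<close>.\<close>

definition cycle_angle :: "(int \<Rightarrow> complex) \<Rightarrow> int \<Rightarrow> real" where
  "cycle_angle v i = angle_at (v (i - 1)) (v i) (v (i + 1))"

definition noether_center :: "nat \<Rightarrow> (int \<Rightarrow> complex) \<Rightarrow> complex \<Rightarrow> real \<Rightarrow> bool" where
  "noether_center N v ctr C \<longleftrightarrow>
     (\<forall>i. (norm (v i - ctr))\<^sup>2 + C =
       (if int N dvd i then cos (cycle_angle v i / 2) / 2 else cos (cycle_angle v i) / 2))"

text \<open>The angles \<open>\<delta>\<^sub>i\<close>, \<open>\<alpha>\<^sub>i\<close>, \<open>\<beta>\<^sub>i\<close> of the triangle \<open>(ctr, v i, v (i + 1))\<close>, and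
  the central deficit \<open>\<eta>\<^sub>i\<close>.\<close>

definition central_angle :: "(int \<Rightarrow> complex) \<Rightarrow> complex \<Rightarrow> int \<Rightarrow> real" where
  "central_angle v ctr i = angle_at (v i) ctr (v (i + 1))"

definition left_angle :: "(int \<Rightarrow> complex) \<Rightarrow> complex \<Rightarrow> int \<Rightarrow> real" where
  "left_angle v ctr i = angle_at ctr (v i) (v (i + 1))"

definition right_angle :: "(int \<Rightarrow> complex) \<Rightarrow> complex \<Rightarrow> int \<Rightarrow> real" where
  "right_angle v ctr i = angle_at ctr (v (i + 1)) (v i)"

definition central_deficit :: "(int \<Rightarrow> complex) \<Rightarrow> complex \<Rightarrow> int \<Rightarrow> real" where
  "central_deficit v ctr i = pi - central_angle v ctr i"

text \<open>Positive orientation costs no generality: reversing the labelling of the cycle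
  (\<open>i \<mapsto> - i\<close>) changes the sign of all the oriented areas.\<close>

definition positive_triangles :: "(int \<Rightarrow> complex) \<Rightarrow> complex \<Rightarrow> bool" where
  "positive_triangles v ctr \<longleftrightarrow> (\<forall>i. Im (cnj (v i - ctr) * (v (i + 1) - ctr)) > 0)"

text \<open>The map \<open>z \<mapsto> a * cnj z\<close> with \<open>norm a = 1\<close> is the general reflection in a line through
  the center.\<close>

definition reflection_symmetric :: "(int \<Rightarrow> complex) \<Rightarrow> complex \<Rightarrow> complex \<Rightarrow> bool" where
  "reflection_symmetric v q ctr \<longleftrightarrow>
     (\<exists>a. norm a = 1 \<and> (\<forall>i. v (- i) - ctr = a * cnj (v i - ctr)) \<and> q - ctr = a * cnj (q - ctr))"

text \<open>The known structure of a maximum-area small \<open>n\<close>-gon (\<open>n \<ge> 8\<close> even) with vertex set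
  \<open>V\<close>, where \<open>N = n - 1\<close>.\<close>

definition maximizer_structure ::
    "nat \<Rightarrow> complex set \<Rightarrow> (int \<Rightarrow> complex) \<Rightarrow> complex \<Rightarrow> complex \<Rightarrow> real \<Rightarrow> bool" where
  "maximizer_structure N V v q ctr C \<longleftrightarrow>
     diameter_labelling N V v q \<and>
     noether_center N v ctr C \<and>
     positive_triangles v ctr \<and>
     (\<forall>i. cycle_angle v i = right_angle v ctr (i - 1) + left_angle v ctr i) \<and>
     (\<forall>i. central_deficit v ctr i = left_angle v ctr i + right_angle v ctr i) \<and>
     (\<Sum>i<N. central_deficit v ctr (int i)) = pi \<and>
     reflection_symmetric v q ctr"

definition limiting_orbit :: "(nat \<Rightarrow> real) \<Rightarrow> bool" where
  "limiting_orbit w \<longleftrightarrow>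
     (\<forall>j. w j > 0) \<and>
     3 * (w 0)\<^sup>2 + (w 0 + w 1)\<^sup>2 = 10 \<and>
     (\<forall>j\<ge>1. (w (j - 1) + w j)\<^sup>2 + (w j + w (j + 1))\<^sup>2 + 2 * (w j)\<^sup>2 = 10) \<and>
     w \<longlonglongrightarrow> 1"

definition lambda_s :: real where
  "lambda_s = (- 3 + sqrt 5) / 2"

definition M_star :: "(nat \<Rightarrow> real) \<Rightarrow> real" where
  "M_star w = 2 * (\<Sum>j. w j - 1)"

end

theory Submission
  imports Defs
begin

text \<open>
  Write \<open>r\<^sub>i\<close> for the distance from the Noether center to cycle vertex \<open>i\<close>, and \<open>\<phi>\<^sub>i\<close> for the
  angle in the Noether relation \<open>r\<^sub>i\<^sup>2 + C = cos \<phi>\<^sub>i / 2\<close>, that is \<open>\<gamma>\<^sub>i\<close>, or \<open>\<theta>\<close> at the marked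
  vertex. The asymptotics come from comparing two expressions for \<open>r\<^sub>i\<^sup>2 + r\<^sub>i\<^sub>+\<^sub>1\<^sup>2\<close>. The Noether
  relation makes it \<open>1 - 2 C - (\<phi>\<^sub>i\<^sup>2 + \<phi>\<^sub>i\<^sub>+\<^sub>1\<^sup>2) / 4\<close> up to fourth order in the angles. The law of
  cosines in the triangle over the unit edge makes it \<open>1 / 2 + \<eta>\<^sub>i\<^sup>2 / 8\<close> up to fourth order.
  Moreover \<open>\<alpha>\<^sub>i\<close> and \<open>\<beta>\<^sub>i\<close> agree to third order, so that away from the marked vertex \<open>\<phi>\<^sub>i\<close> is
  nearly \<open>(\<eta>\<^sub>i\<^sub>-\<^sub>1 + \<eta>\<^sub>i) / 2\<close>. Hence
  \<open>(\<eta>\<^sub>i\<^sub>-\<^sub>1 + \<eta>\<^sub>i)\<^sup>2 + (\<eta>\<^sub>i + \<eta>\<^sub>i\<^sub>+\<^sub>1)\<^sup>2 + 2 \<eta>\<^sub>i\<^sup>2\<close> is nearly the constant \<open>8 - 32 C\<close>: after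
  division by a suitable scale \<open>a\<close> the deficits satisfy the recurrence of the limiting orbit
  (\<open>deficits_near_scaled_orbit\<close>). At the marked vertex \<open>\<theta>\<close> is nearly \<open>\<eta>\<^sub>0 / 2\<close>, which gives the
  boundary form \<open>3 \<eta>\<^sub>0\<^sup>2 + (\<eta>\<^sub>0 + \<eta>\<^sub>1)\<^sup>2\<close>.

  These expansions require every angle to be \<open>O(1/N)\<close>. The angles \<open>\<gamma>\<^sub>i\<close> sum to \<open>\<pi>\<close>, so some two
  consecutive ones are \<open>O(1/N)\<close>. That single pair forces \<open>C \<ge> 1/4 - O(1/N\<^sup>2)\<close>; then every \<open>r\<^sub>i\<close>
  is at most \<open>1/2 + O(1/N\<^sup>2)\<close>, hence, since \<open>r\<^sub>i + r\<^sub>i\<^sub>+\<^sub>1 \<ge> 1\<close>, also at least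
  \<open>1/2 - O(1/N\<^sup>2)\<close>, and the Noether relation bounds every \<open>\<phi>\<^sub>i\<close> (\<open>C_lower\<close>,
  \<open>radius_near_half\<close>, \<open>all_angles_small\<close>).

  The recurrence is stable for a reason visible from its form: the difference of two positive
  solutions solves a linear tridiagonal system in which the diagonal exceeds the sum of the
  off-diagonal entries by at least \<open>2 (x\<^sub>j + w\<^sub>j)\<close>. By the maximum principle the sup norm of the difference
  is bounded by the residuals (\<open>orbit_comparison\<close>). The residuals are \<open>O(1/N\<^sup>2)\<close> from the
  expansions and \<open>O(2\<^sup>-\<^sup>m)\<close> from the far end of the half-cycle, where the deficits are reflected
  but \<open>w\<close> is not. Finally \<open>\<Sum>\<eta> = \<pi>\<close> determines \<open>a\<close> as \<open>\<pi> / (N + M)\<close> to the required accuracy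
  (\<open>deficit_near_orbit\<close>), and the expansion of \<open>w\<close> gives the second estimate.
\<close>

section \<open>Stability of the recurrence of the limiting orbit\<close>

text \<open>
  The quadratic form in the recurrence of the limiting orbit, including its boundary case.
  Homogeneity is what allows solutions to be rescaled.
\<close>

definition orbit_form :: "(nat \<Rightarrow> real) \<Rightarrow> nat \<Rightarrow> real" where
  "orbit_form x j =
     (if j = 0 then 3 * (x 0)\<^sup>2 + (x 0 + x 1)\<^sup>2
      else (x (j - 1) + x j)\<^sup>2 + (x j + x (j + 1))\<^sup>2 + 2 * (x j)\<^sup>2)"

lemma orbit_form_limiting_orbit: "limiting_orbit w \<Longrightarrow> orbit_form w j = 10"
  by (cases j) (auto simp: limiting_orbit_def orbit_form_def)

lemma orbit_form_ge: "2 * (x j)\<^sup>2 \<le> orbit_form x j"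
  by (auto simp: orbit_form_def intro: add_nonneg_nonneg)

lemma orbit_form_scale: "orbit_form (\<lambda>j. b * x j) j = b\<^sup>2 * orbit_form x j"
  by (simp add: orbit_form_def power2_eq_square algebra_simps)

text \<open>
  One row of a tridiagonal system, read at an index where \<open>\<bar>d\<bar>\<close> is the maximum \<open>D\<close>: the off-diagonal
  terms can cancel at most \<open>(P + R) * D\<close>, so the excess \<open>s\<close> of the diagonal controls \<open>D\<close>. The
  slack \<open>t\<close> allows the right neighbour to exceed the maximum slightly.
\<close>

lemma diagonal_dominance:
  fixes P R s D t :: real
  assumes "P \<ge> 0" "R \<ge> 0" "s > 0" "\<bar>d\<bar> = D" "\<bar>d1\<bar> \<le> D" "\<bar>d2\<bar> \<le> D + t"
    "\<bar>P * (d1 + d) + R * (d + d2) + s * d\<bar> \<le> \<rho>"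
  shows "s * D \<le> \<rho> + R * t"
proof -
  have 1: "P * \<bar>d1\<bar> \<le> P * D" "R * \<bar>d2\<bar> \<le> R * (D + t)"
    using assms by (auto intro: mult_left_mono)
  have "(P + R + s) * D = \<bar>(P + R + s) * d\<bar>" using assms by (simp add: abs_mult)
  also have "(P + R + s) * d = (P * (d1 + d) + R * (d + d2) + s * d) - P * d1 - R * d2"
    by (simp add: algebra_simps)
  also have "\<bar>\<dots>\<bar> \<le> \<rho> + P * \<bar>d1\<bar> + R * \<bar>d2\<bar>"
    using assms(1,2,7) abs_mult[of P d1] abs_mult[of R d2]
      abs_triangle_ineq4[of "P * (d1 + d) + R * (d + d2) + s * d" "P * d1"]
      abs_triangle_ineq4[of "P * (d1 + d) + R * (d + d2) + s * d - P * d1" "R * d2"]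
    by simp
  finally show ?thesis using 1 by (simp add: algebra_simps)
qed

text \<open>
  The maximum principle for the recurrence. Factoring each difference of squares turns the
  difference of the two forms into a row for \<open>x - w\<close> with excess \<open>2 * (x k + w k)\<close> (or
  \<open>3 * (x 0 + w 0)\<close> at the boundary), which positivity bounds below. The sequence \<open>x\<close> is reflected
  at \<open>m - 1\<close> and \<open>w\<close> is not; the mismatch \<open>w m - w (m - 2)\<close> enters as the slack at the last
  index. The bound \<open>\<rho> \<le> 8\<close> keeps every entry of \<open>x\<close> at most \<open>3\<close>, whence the
  factor \<open>12\<close>, a bound on \<open>x k + w k + x (k + 1) + w (k + 1)\<close>.
\<close>

lemma orbit_comparison:
  fixes x w :: "nat \<Rightarrow> real"
  assumes m: "m \<ge> 2" and x: "\<And>j. j \<le> m \<Longrightarrow> x j \<ge> 0" and w: "\<And>j. w j \<ge> \<omega>" and \<omega>: "\<omega> > 0"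
    and Qw: "\<And>j. orbit_form w j = 10"
    and Qx: "\<And>j. j < m \<Longrightarrow> \<bar>orbit_form x j - 10\<bar> \<le> \<rho>"
    and \<rho>: "\<rho> \<le> 8" and refl: "x m = x (m - 2)" and j: "j < m"
  shows "\<bar>x j - w j\<bar> \<le> (\<rho> + 12 * \<bar>w m - w (m - 2)\<bar>) / (2 * \<omega>)"
proof -
  define e where "e i = x i - w i" for i
  define D where "D = Max ((\<lambda>i. \<bar>e i\<bar>) ` {..<m})"
  define t where "t = \<bar>w m - w (m - 2)\<bar>"
  have le3: "y \<le> 3" if "2 * y\<^sup>2 \<le> 18" for y :: real
    using that by (auto intro!: power2_le_imp_le[of y 3])
  have x3: "x i \<le> 3" if "i < m" for i
    using orbit_form_ge[of x i] Qx[OF that] \<rho> by (intro le3) linarith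
  have x3': "x i \<le> 3" if "i \<le> m" for i
    using that x3[of i] x3[of "m - 2"] refl m by (cases "i = m") auto
  have w3: "w i \<le> 3" for i
    using orbit_form_ge[of w i] Qw[of i] by (intro le3) linarith
  have wpos: "w i > 0" for i using w[of i] \<omega> by linarith
  have De: "\<bar>e i\<bar> \<le> D" if "i < m" for i
    unfolding D_def using that by (intro Max_ge) auto
  have De': "\<bar>e (i + 1)\<bar> \<le> D + t" if "i < m" for i
  proof (cases "i + 1 = m")
    case True
    have "e m = e (m - 2) + (w (m - 2) - w m)" by (simp add: e_def refl)
    then have "\<bar>e m\<bar> \<le> D + t"
      using De[of "m - 2"] m abs_triangle_ineq[of "e (m - 2)" "w (m - 2) - w m"]
      by (simp add: t_def abs_minus_commute)
    then show ?thesis using True by simp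
  next
    case False
    then show ?thesis using De[of "i + 1"] that by (simp add: t_def)
  qed
  have "D \<in> (\<lambda>i. \<bar>e i\<bar>) ` {..<m}"
    unfolding D_def using m by (intro Max_in) (auto simp: lessThan_empty_iff)
  then obtain k where k: "k < m" "\<bar>e k\<bar> = D" by auto
  define s where "s i = x i + w i" for i
  have s0: "s i \<ge> \<omega>" "s i \<le> 6" if "i \<le> m" for i
    using x[OF that] w[of i] x3'[OF that] w3[of i] by (auto simp: s_def)
  have diff: "\<bar>orbit_form x k - orbit_form w k\<bar> \<le> \<rho>" using Qx[OF k(1)] Qw by simp
  have "2 * s k * D \<le> \<rho> + (s k + s (k + 1)) * t"
  proof (cases k)
    case 0
    have "orbit_form x k - orbit_form w k =
      0 * (0 + e k) + (s k + s (k + 1)) * (e k + e (k + 1)) + 3 * s k * e k"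
      by (simp add: 0 orbit_form_def s_def e_def power2_eq_square algebra_simps)
    then have "\<bar>0 * (0 + e k) + (s k + s (k + 1)) * (e k + e (k + 1)) + 3 * s k * e k\<bar> \<le> \<rho>"
      using diff by simp
    moreover have "s k > 0" "s k + s (k + 1) \<ge> 0" "D \<ge> 0"
      using s0[of k] s0[of "k + 1"] k \<omega> by auto
    ultimately have "3 * s k * D \<le> \<rho> + (s k + s (k + 1)) * t"
      using k De'[of k] by (intro diagonal_dominance[of 0 _ _ "e k" D 0 "e (k + 1)"]) simp_all
    moreover have "2 * s k * D \<le> 3 * s k * D"
      using s0[of k] k \<omega> by (intro mult_right_mono) auto
    ultimately show ?thesis by linarith
  next
    case (Suc l)
    have "orbit_form x k - orbit_form w k =
      (s l + s k) * (e l + e k) + (s k + s (k + 1)) * (e k + e (k + 1)) + 2 * s k * e k"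
      by (simp add: Suc orbit_form_def s_def e_def power2_eq_square algebra_simps)
    then have "\<bar>(s l + s k) * (e l + e k) + (s k + s (k + 1)) * (e k + e (k + 1)) + 2 * s k * e k\<bar> \<le> \<rho>"
      using diff by simp
    moreover have "s k > 0" "s l + s k \<ge> 0" "s k + s (k + 1) \<ge> 0" "l < m"
      using s0[of l] s0[of k] s0[of "k + 1"] k \<omega> Suc by auto
    ultimately show ?thesis
      using k De'[of k] De[of l]
      by (intro diagonal_dominance[of "s l + s k" _ _ "e k" D "e l" "e (k + 1)"]) simp_all
  qed
  also have "(s k + s (k + 1)) * t \<le> 12 * t"
    using s0[of k] s0[of "k + 1"] k by (intro mult_right_mono) (auto simp: t_def)
  finally have "2 * s k * D \<le> \<rho> + 12 * t" by simp
  moreover have "2 * \<omega> * D \<le> 2 * s k * D"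
    using s0[of k] k by (intro mult_right_mono) auto
  ultimately have "D \<le> (\<rho> + 12 * t) / (2 * \<omega>)"
    using \<omega> by (simp add: field_simps)
  then show ?thesis using De[OF j] by (simp add: e_def t_def)
qed

section \<open>Triangles over the unit edges\<close>

text \<open>
  The apex \<open>p\<close> projects onto the line through the base, and its height is the same seen from both
  ends.
\<close>

lemma unit_base_triangle:
  fixes p x y :: complex
  assumes base: "dist x y = 1" and pos: "x \<noteq> p" "y \<noteq> p"
  shows "norm (x - p) * cos (angle_at p x y) + norm (y - p) * cos (angle_at p y x) = 1"
    and "norm (x - p) * sin (angle_at p x y) = norm (y - p) * sin (angle_at p y x)"
proof -
  have cs: "norm (b - a) * cos (angle_at a b c) = (a - b) \<bullet> (c - b)"
      "(norm (b - a) * sin (angle_at a b c))\<^sup>2 = (norm (b - a))\<^sup>2 - ((a - b) \<bullet> (c - b))\<^sup>2"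
      "0 \<le> norm (b - a) * sin (angle_at a b c)"
    if "dist b c = 1" "b \<noteq> a" for a b c :: complex
  proof -
    define q where "q = ((a - b) \<bullet> (c - b)) / norm (b - a)"
    have nb: "norm (b - a) > 0" using that by simp
    have n1: "norm (c - b) = 1" using that(1) by (metis dist_commute dist_norm)
    have ab: "norm (a - b) = norm (b - a)" by (rule norm_minus_commute)
    have ang: "angle_at a b c = arccos q"
      unfolding angle_at_def q_def n1 ab by simp
    have "\<bar>(a - b) \<bullet> (c - b)\<bar> \<le> norm (b - a)"
      using Cauchy_Schwarz_ineq2[of "a - b" "c - b"] unfolding n1 ab by simp
    then have q1: "\<bar>q\<bar> \<le> 1" using nb by (simp add: q_def)
    have qn: "norm (b - a) * q = (a - b) \<bullet> (c - b)" using nb by (simp add: q_def)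
    show "norm (b - a) * cos (angle_at a b c) = (a - b) \<bullet> (c - b)"
      using q1 qn by (simp add: ang cos_arccos_abs)
    have "(norm (b - a) * sin (angle_at a b c))\<^sup>2 = (norm (b - a))\<^sup>2 * (1 - q\<^sup>2)"
      using q1 by (simp add: ang power_mult_distrib sin_squared_eq cos_arccos_abs)
    then show "(norm (b - a) * sin (angle_at a b c))\<^sup>2 = (norm (b - a))\<^sup>2 - ((a - b) \<bullet> (c - b))\<^sup>2"
      unfolding qn[symmetric] by (simp add: power_mult_distrib right_diff_distrib)
    have "0 \<le> sin (arccos q)" using q1 by (intro sin_ge_zero arccos_lbound arccos_ubound) auto
    then show "0 \<le> norm (b - a) * sin (angle_at a b c)" by (simp add: ang)
  qed
  have base': "dist y x = 1" using base by (simp add: dist_commute)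
  define X where "X = x - p"
  define Y where "Y = y - p"
  have n1: "(X - Y) \<bullet> (X - Y) = 1"
    using base by (simp add: X_def Y_def dot_square_norm dist_norm)
  have e1: "(p - x) \<bullet> (y - x) = X \<bullet> X - X \<bullet> Y" 
    and e2: "(p - y) \<bullet> (x - y) = Y \<bullet> Y - X \<bullet> Y"
    by (simp_all add: X_def Y_def inner_diff inner_commute)
  have n2: "X \<bullet> X + Y \<bullet> Y - 2 * (X \<bullet> Y) = 1"
    using n1 by (simp add: inner_diff inner_commute)
  show "norm (x - p) * cos (angle_at p x y) + norm (y - p) * cos (angle_at p y x) = 1"
    using cs(1)[OF base pos(1)] cs(1)[OF base' pos(2)] n2 e1 e2 by simp
  have "(X \<bullet> X - (X \<bullet> X - X \<bullet> Y)\<^sup>2) - (Y \<bullet> Y - (Y \<bullet> Y - X \<bullet> Y)\<^sup>2)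
      = (X \<bullet> X - Y \<bullet> Y) * (1 - (X \<bullet> X + Y \<bullet> Y - 2 * (X \<bullet> Y)))"
    by (simp add: power2_eq_square algebra_simps)
  then have "(norm (x - p) * sin (angle_at p x y))\<^sup>2 = (norm (y - p) * sin (angle_at p y x))\<^sup>2"
    using cs(2)[OF base pos(1)] cs(2)[OF base' pos(2)] n2 e1 e2
    by (simp add: X_def Y_def dot_square_norm)
  then show "norm (x - p) * sin (angle_at p x y) = norm (y - p) * sin (angle_at p y x)"
    using cs(3)[OF base pos(1)] cs(3)[OF base' pos(2)] by (rule power2_eq_imp_eq)
qed

lemma angle_at_bounds: "0 \<le> angle_at x y z" "angle_at x y z \<le> pi"
proof -
  define q where "q = ((x - y) \<bullet> (z - y)) / (norm (x - y) * norm (z - y))"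
  have "\<bar>q\<bar> \<le> 1"
    using Cauchy_Schwarz_ineq2[of "x - y" "z - y"]
    by (auto simp: q_def divide_le_eq_1 abs_mult)
  then show "0 \<le> angle_at x y z" "angle_at x y z \<le> pi"
    by (auto simp: angle_at_def q_def[symmetric] intro: arccos_lbound arccos_ubound)
qed

lemma angle_at_reflection:
  assumes "norm a = 1" "x' - p = a * cnj (x - p)" "y' - p = a * cnj (y - p)"
  shows "angle_at p x' y' = angle_at p x y"
proof -
  have in': "(a * cnj u) \<bullet> (a * cnj s) = u \<bullet> s" for u s
  proof -
    have "(a * cnj u) \<bullet> (a * cnj s) = Re ((a * cnj a) * (cnj u * s))"
      by (simp add: inner_complex_def algebra_simps)
    also have "a * cnj a = 1" using assms(1) by (simp add: complex_norm_square[symmetric])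
    finally show ?thesis by (simp add: inner_complex_def)
  qed
  have "p - x' = - (x' - p)" "y' - x' = (y' - p) - (x' - p)" by simp_all
  then have d: "p - x' = a * cnj (p - x)" "y' - x' = a * cnj (y - x)"
    unfolding assms(2,3) by (simp_all add: algebra_simps)
  show ?thesis unfolding angle_at_def d in' by (simp only: norm_mult assms(1) complex_mod_cnj mult_1)
qed

text \<open>
  The real data of the configuration: radii, base angles, deficits and vertex angles. The two
  base equations carry all the triangle geometry; the reflection of the polygon enters only
  through \<open>\<beta>\<^sub>-\<^sub>i\<^sub>-\<^sub>1 = \<alpha>\<^sub>i\<close>.
\<close>

locale noether_cycle =
  fixes N :: nat and C :: real and r \<alpha> \<beta> \<eta> \<gamma> :: "int \<Rightarrow> real"
  assumes N_pos: "N > 0"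
    and r_nonneg: "r i \<ge> 0"
    and \<alpha>_nonneg: "\<alpha> i \<ge> 0" and \<beta>_nonneg: "\<beta> i \<ge> 0"
    and \<gamma>_le_pi: "\<gamma> i \<le> pi"
    and base_projection: "r i * cos (\<alpha> i) + r (i + 1) * cos (\<beta> i) = 1"
    and base_height: "r i * sin (\<alpha> i) = r (i + 1) * sin (\<beta> i)"
    and \<eta>_eq: "\<eta> i = \<alpha> i + \<beta> i"
    and \<gamma>_eq: "\<gamma> i = \<beta> (i - 1) + \<alpha> i"
    and noether: "(r i)\<^sup>2 + C = cos (if int N dvd i then \<gamma> i / 2 else \<gamma> i) / 2"
    and \<eta>_periodic: "\<eta> (i + int N) = \<eta> i"
    and \<eta>_sum: "(\<Sum>i<N. \<eta> (int i)) = pi"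
    and \<beta>_reflected: "\<beta> (- i - 1) = \<alpha> i"

lemma noether_cycle_of_maximizer:
  assumes S: "maximizer_structure N V v q ctr C" and N: "N > 0"
  shows "noether_cycle N C (\<lambda>i. norm (v i - ctr)) (left_angle v ctr) (right_angle v ctr)
           (central_deficit v ctr) (cycle_angle v)"
proof -
  note S' = S[unfolded maximizer_structure_def]
  have lab: "diameter_labelling N V v q" using S' by blast
  have per: "v (i + int N) = v i" for i using lab by (auto simp: diameter_labelling_def)
  have inV: "v i \<in> V" for i using lab by (auto simp: diameter_labelling_def)
  have unit: "dist (v i) (v (i + 1)) = 1" for i
    using lab inV[of i] inV[of "i + 1"] unfolding diameter_labelling_def by blast
  \<comment> \<open>Strict positivity of the oriented areas excludes a vertex at the center.\<close>
  have pos: "v i \<noteq> ctr" for i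
  proof
    assume "v i = ctr"
    moreover have "Im (cnj (v i - ctr) * (v (i + 1) - ctr)) > 0"
      using S' unfolding positive_triangles_def by blast
    ultimately show False by simp
  qed
  have refl: "right_angle v ctr (- i - 1) = left_angle v ctr i" for i
  proof -
    obtain a where a: "norm a = 1" "\<And>i. v (- i) - ctr = a * cnj (v i - ctr)"
      using S' unfolding reflection_symmetric_def by blast
    show ?thesis unfolding right_angle_def left_angle_def
      using angle_at_reflection[OF a(1) a(2)[of i] a(2)[of "i + 1"]] by simp
  qed
  have per': "v (1 + (i + int N)) = v (1 + i)" for i using per[of "1 + i"] by (simp add: ac_simps)
  have perd: "central_deficit v ctr (i + int N) = central_deficit v ctr i" for i
    using per per' by (simp add: central_deficit_def central_angle_def add.commute)
  show ?thesis
  proof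
    show "(norm (v i - ctr))\<^sup>2 + C =
        cos (if int N dvd i then cycle_angle v i / 2 else cycle_angle v i) / 2" for i
      using S' by (auto simp: noether_center_def)
    show "norm (v i - ctr) * cos (left_angle v ctr i) +
        norm (v (i + 1) - ctr) * cos (right_angle v ctr i) = 1" for i
      unfolding left_angle_def right_angle_def by (rule unit_base_triangle[OF unit pos pos])
    show "norm (v i - ctr) * sin (left_angle v ctr i) =
        norm (v (i + 1) - ctr) * sin (right_angle v ctr i)" for i
      unfolding left_angle_def right_angle_def by (rule unit_base_triangle[OF unit pos pos])
    show "cycle_angle v i \<le> pi" for i
      unfolding cycle_angle_def by (rule angle_at_bounds)
    show "cycle_angle v i = right_angle v ctr (i - 1) + left_angle v ctr i" for i
      using S' by blast
    show "central_deficit v ctr i = left_angle v ctr i + right_angle v ctr i" for i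
      using S' by blast
    show "(\<Sum>i<N. central_deficit v ctr (int i)) = pi"
      using S' by blast
  qed (use N perd refl in \<open>simp_all add: left_angle_def right_angle_def angle_at_bounds\<close>)
qed

section \<open>All angles are of order 1/N\<close>

lemma cos_quadratic_approx: "\<bar>cos x - (1 - x\<^sup>2 / 2)\<bar> \<le> x ^ 4 / (24::real)"
proof -
  obtain t where t: "cos x = (\<Sum>m<4. cos_coeff m * x ^ m) + cos (t + 1/2 * real 4 * pi) / fact 4 * x ^ 4"
    using Maclaurin_cos_expansion[of x 4] by blast
  have "(\<Sum>m<4. cos_coeff m * x ^ m) = 1 - x\<^sup>2 / 2"
    by (simp add: cos_coeff_def eval_nat_numeral) presburger
  then have "cos x - (1 - x\<^sup>2 / 2) = cos (t + 1/2 * real 4 * pi) * (x ^ 4 / 24)"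
    using t by (simp add: fact_numeral)
  moreover have "\<bar>cos (t + 1/2 * real 4 * pi) * (x ^ 4 / 24)\<bar> \<le> 1 * (x ^ 4 / 24)"
    unfolding abs_mult by (intro mult_mono) auto
  ultimately show ?thesis by (metis mult_1)
qed

lemma cos_ge_quadratic: "1 - x\<^sup>2 / 2 \<le> cos (x::real)"
proof -
  have "(sin (x/2))\<^sup>2 \<le> (x/2)\<^sup>2"
    using abs_sin_le_one abs_sin_x_le_abs_x[of "x/2"] by (metis abs_le_square_iff)
  then show ?thesis using cos_double_sin[of "x/2"] by (simp add: power_divide)
qed

text \<open>
  The hypothesis first forces \<open>g < \<pi> / 2\<close>, and there the quartic term of the cosine costs only a
  fraction of the quadratic one.
\<close>

lemma cos_le_near_one_imp:
  assumes "0 \<le> g" "g \<le> pi" "1 - 4 * \<epsilon>\<^sup>2 \<le> cos g" "0 \<le> \<epsilon>" "\<epsilon> \<le> 1/10"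
  shows "g \<le> 4 * \<epsilon>"
proof -
  have e2: "\<epsilon>\<^sup>2 \<le> 1/100" using power_mono[OF assms(5,4), of 2] by (simp add: power2_eq_square)
  have "g < pi / 2"
  proof (rule ccontr)
    assume "\<not> g < pi / 2"
    then have "cos g \<le> cos (pi / 2)" using assms by (intro cos_monotone_0_pi_le) auto
    then show False using assms(3) e2 by simp
  qed
  then have g2: "g \<le> 2" using pi_less_4 by simp
  have "g ^ 4 = g\<^sup>2 * g\<^sup>2" by (simp add: power2_eq_square power4_eq_xxxx)
  also have "\<dots> \<le> g\<^sup>2 * 4" using power_mono[OF g2 assms(1), of 2] by (intro mult_left_mono) auto
  finally have "g ^ 4 \<le> g\<^sup>2 * 4" .
  then have "g\<^sup>2 \<le> 12 * \<epsilon>\<^sup>2" using cos_quadratic_approx[of g] assms(3) by linarith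
  also have "\<dots> \<le> (4 * \<epsilon>)\<^sup>2" by (simp add: power_mult_distrib)
  finally show ?thesis by (rule power2_le_imp_le) (use assms(4) in simp)
qed

lemma sin_diff_lower:
  assumes "0 \<le> a" "a \<le> 1" "0 \<le> b" "b \<le> (1::real)"
  shows "\<bar>a - b\<bar> \<le> 2 * \<bar>sin a - sin b\<bar>"
proof -
  have *: "y - x \<le> 2 * (sin y - sin x)" if "0 \<le> x" "x \<le> y" "y \<le> 1" for x y :: real
  proof -
    have "sin x - x / 2 \<le> sin y - y / 2"
    proof (rule DERIV_nonneg_imp_nondecreasing[OF that(2)])
      fix z assume z: "x \<le> z" "z \<le> y"
      then have "z\<^sup>2 \<le> 1" using that by (simp add: power_le_one)
      then have "0 \<le> cos z - 1 / 2" using cos_ge_quadratic[of z] by linarith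
      then show "\<exists>d. ((\<lambda>u. sin u - u / 2) has_real_derivative d) (at z) \<and> 0 \<le> d"
        by (intro exI[of _ "cos z - 1 / 2"] conjI) (auto intro!: derivative_eq_intros)
    qed
    then show ?thesis by simp
  qed
  show ?thesis using *[of a b] *[of b a] assms by (cases "a \<le> b") auto
qed

lemma sum_periodic_shift:
  fixes f :: "int \<Rightarrow> real"
  assumes "\<And>i. f (i + int N) = f i"
  shows "(\<Sum>i<N. f (int i + 1)) = (\<Sum>i<N. f (int i))"
proof -
  have "f 0 + (\<Sum>i<N. f (int (Suc i))) = (\<Sum>i<Suc N. f (int i))"
    by (subst sum.lessThan_Suc_shift) simp
  also have "\<dots> = (\<Sum>i<N. f (int i)) + f 0" using assms[of 0] by simp
  finally show ?thesis by (simp add: add.commute)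
qed

context noether_cycle
begin

text \<open>
  The angle in the Noether relation; at the marked vertex it is \<open>\<theta>\<close>, since \<open>\<gamma>\<close> is \<open>2 * \<theta>\<close> there.
\<close>

definition \<phi> :: "int \<Rightarrow> real" where
  "\<phi> i = (if int N dvd i then \<gamma> i / 2 else \<gamma> i)"

lemma \<gamma>_nonneg: "\<gamma> i \<ge> 0"
  using \<gamma>_eq \<alpha>_nonneg \<beta>_nonneg by simp

lemma \<eta>_nonneg: "\<eta> i \<ge> 0"
  using \<eta>_eq \<alpha>_nonneg \<beta>_nonneg by simp

lemma \<alpha>_le: "\<alpha> i \<le> \<gamma> i" and \<beta>_le: "\<beta> i \<le> \<gamma> (i + 1)"
  using \<gamma>_eq[of i] \<gamma>_eq[of "i + 1"] \<alpha>_nonneg \<beta>_nonneg by simp_all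

lemma \<phi>_bounds: "0 \<le> \<phi> i" "\<phi> i \<le> \<gamma> i" "\<gamma> i \<le> 2 * \<phi> i"
  using \<gamma>_nonneg by (auto simp: \<phi>_def)

lemma noether_\<phi>: "(r i)\<^sup>2 + C = cos (\<phi> i) / 2"
  using noether by (simp add: \<phi>_def)

lemma r_sum_ge: "r i + r (i + 1) \<ge> 1"
proof -
  have "r i * cos (\<alpha> i) + r (i + 1) * cos (\<beta> i) \<le> r i * 1 + r (i + 1) * 1"
    by (intro add_mono mult_left_mono) (auto simp: r_nonneg)
  then show ?thesis by (simp add: base_projection)
qed

lemma law_of_cosines: "(r i)\<^sup>2 + (r (i + 1))\<^sup>2 + 2 * r i * r (i + 1) * cos (\<eta> i) = 1"
proof -
  have "(r i)\<^sup>2 + (r (i + 1))\<^sup>2 + 2 * r i * r (i + 1) * cos (\<eta> i) =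
      (r i)\<^sup>2 * ((sin (\<alpha> i))\<^sup>2 + (cos (\<alpha> i))\<^sup>2) + (r (i + 1))\<^sup>2 * ((sin (\<beta> i))\<^sup>2 + (cos (\<beta> i))\<^sup>2)
      + 2 * r i * r (i + 1) * (cos (\<alpha> i) * cos (\<beta> i) - sin (\<alpha> i) * sin (\<beta> i))"
    by (simp add: \<eta>_eq cos_add)
  also have "\<dots> = (r i * cos (\<alpha> i) + r (i + 1) * cos (\<beta> i))\<^sup>2 +
      (r i * sin (\<alpha> i) - r (i + 1) * sin (\<beta> i))\<^sup>2"
    by algebra
  finally show ?thesis by (simp add: base_projection base_height)
qed

text \<open>
  Two consecutive vertex angles involve only three consecutive deficits, and over the cycle the
  sum of three consecutive deficits has mean \<open>3 * \<pi> / N\<close>.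
\<close>

lemma ex_small_angles: "\<exists>i. \<gamma> i + \<gamma> (i + 1) \<le> 12 / N"
proof (rule ccontr)
  assume "\<not> ?thesis"
  then have big: "\<gamma> i + \<gamma> (i + 1) > 12 / N" for i by (simp add: not_le)
  have le: "\<gamma> (i + 1) + \<gamma> (i + 2) \<le> \<eta> i + \<eta> (i + 1) + \<eta> (i + 2)" for i
    using \<gamma>_eq[of "i + 1"] \<gamma>_eq[of "i + 2"] \<alpha>_nonneg[of i] \<beta>_nonneg[of "i + 2"]
    by (simp add: \<eta>_eq add.commute[of 1 i])
  have s1: "(\<Sum>i<N. \<eta> (int i + 1)) = pi"
    using sum_periodic_shift[of \<eta> N] \<eta>_periodic \<eta>_sum by simp
  have s2: "(\<Sum>i<N. \<eta> (int i + 2)) = pi"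
  proof -
    have "\<eta> (i + int N + 1) = \<eta> (i + 1)" for i
      using \<eta>_periodic[of "i + 1"] by (simp add: ac_simps)
    from sum_periodic_shift[of "\<lambda>i. \<eta> (i + 1)" N, OF this] s1 show ?thesis
      by (simp add: add.assoc)
  qed
  have "12 = (\<Sum>i<N. 12 / N)" using N_pos by simp
  also have "\<dots> \<le> (\<Sum>i<N. \<gamma> (int i + 1) + \<gamma> (int i + 2))"
  proof (rule sum_mono)
    show "12 / real N \<le> \<gamma> (int i + 1) + \<gamma> (int i + 2)" for i
      using big[of "int i + 1"] by (simp add: add.assoc)
  qed
  also have "\<dots> \<le> (\<Sum>i<N. \<eta> (int i) + \<eta> (int i + 1) + \<eta> (int i + 2))"
    by (intro sum_mono le)
  also have "\<dots> = 3 * pi" by (simp add: sum.distrib s1 s2 \<eta>_sum)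
  finally show False using pi_less_4 by simp
qed

lemma ex_large_deficit: "\<exists>i. \<eta> i \<ge> pi / N"
proof (rule ccontr)
  assume "\<not> ?thesis"
  then have "(\<Sum>i<N. \<eta> (int i)) < (\<Sum>i<N. pi / N)"
    using N_pos by (intro sum_strict_mono) (auto simp: not_le)
  then show False using \<eta>_sum N_pos by simp
qed

text \<open>
  The squared radii differ by a difference of cosines of small angles; dividing by
  \<open>r i + r (i + 1) \<ge> 1\<close> passes to the radii.
\<close>

lemma radius_diff_le: 
  assumes "\<phi> i \<le> E" "\<phi> (i + 1) \<le> E"
  shows "\<bar>r i - r (i + 1)\<bar> \<le> E\<^sup>2 / 4"
proof -
  have c: "1 - E\<^sup>2 / 2 \<le> cos (\<phi> k)" if "\<phi> k \<le> E" for k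
    using cos_ge_quadratic[of "\<phi> k"] power_mono[OF that \<phi>_bounds(1), of 2] by linarith
  have "\<bar>r i - r (i + 1)\<bar> * 1 \<le> \<bar>r i - r (i + 1)\<bar> * (r i + r (i + 1))"
    by (intro mult_left_mono r_sum_ge) simp
  also have "\<dots> = \<bar>(r i - r (i + 1)) * (r i + r (i + 1))\<bar>"
    using r_nonneg[of i] r_nonneg[of "i + 1"] by (simp add: abs_mult)
  also have "(r i - r (i + 1)) * (r i + r (i + 1)) = cos (\<phi> i) / 2 - cos (\<phi> (i + 1)) / 2"
    using noether_\<phi>[of i] noether_\<phi>[of "i + 1"] by (simp add: power2_eq_square algebra_simps)
  also have "\<bar>\<dots>\<bar> \<le> E\<^sup>2 / 4"
    using c[OF assms(1)] c[OF assms(2)] cos_le_one[of "\<phi> i"] cos_le_one[of "\<phi> (i + 1)"]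
    by linarith
  finally show ?thesis by simp
qed

text \<open>
  A pair of small angles determines \<open>C\<close>: flatness of the triangle bounds \<open>r i + r (i + 1)\<close> by
  \<open>1 + O(\<epsilon>\<^sup>2)\<close>, the two radii nearly agree, so both squares are at most \<open>1/4 + O(\<epsilon>\<^sup>2)\<close>, while the
  cosines are close to \<open>1\<close>.
\<close>

lemma C_lower:
  assumes eps: "0 \<le> \<epsilon>" "\<epsilon> \<le> 1/10" and small: "\<gamma> i \<le> \<epsilon>" "\<gamma> (i + 1) \<le> \<epsilon>"
  shows "C \<ge> 1/4 - \<epsilon>\<^sup>2"
proof -
  define e where "e = \<epsilon>\<^sup>2"
  have e: "0 \<le> e" "e \<le> 1/100"
    using power_mono[OF eps(2,1), of 2] by (auto simp: e_def power2_eq_square)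
  have e2: "e * e \<le> e / 100" using mult_left_mono[OF e(2,1)] by simp
  have cosge: "1 - e / 2 \<le> cos x" if "0 \<le> x" "x \<le> \<epsilon>" for x
    using cos_ge_quadratic[of x] power_mono[OF that(2,1), of 2] by (simp add: e_def)
  have small_ang: "\<alpha> i \<le> \<epsilon>" "\<beta> i \<le> \<epsilon>" "\<phi> i \<le> \<epsilon>" "\<phi> (i + 1) \<le> \<epsilon>"
    using small \<alpha>_le[of i] \<beta>_le[of i] \<phi>_bounds(2)[of i] \<phi>_bounds(2)[of "i + 1"] by linarith+
  have "(r i + r (i + 1)) * (1 - e / 2) = r i * (1 - e / 2) + r (i + 1) * (1 - e / 2)"
    by (simp add: algebra_simps)
  also have "\<dots> \<le> r i * cos (\<alpha> i) + r (i + 1) * cos (\<beta> i)"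
    using small_ang by (intro add_mono mult_left_mono cosge r_nonneg \<alpha>_nonneg \<beta>_nonneg)
  finally have s: "(r i + r (i + 1)) * (1 - e / 2) \<le> 1" by (simp add: base_projection)
  have "1 \<le> (1 + e) * (1 - e / 2)" using e e2 by (simp add: algebra_simps)
  with s have "(r i + r (i + 1)) * (1 - e / 2) \<le> (1 + e) * (1 - e / 2)" by linarith
  then have "r i + r (i + 1) \<le> 1 + e" using e by (simp add: mult_le_cancel_right)
  then have "(r i + r (i + 1))\<^sup>2 \<le> (1 + e)\<^sup>2"
    using r_nonneg[of i] r_nonneg[of "i + 1"] by (intro power_mono) auto
  also have "\<dots> \<le> 1 + 201/100 * e" using e2 by (simp add: power2_eq_square algebra_simps)
  finally have sum: "(r i + r (i + 1))\<^sup>2 \<le> 1 + 201/100 * e" .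
  have "\<bar>r i - r (i + 1)\<bar>\<^sup>2 \<le> (e / 4)\<^sup>2"
    using radius_diff_le[OF small_ang(3,4)] by (intro power_mono) (auto simp: e_def)
  then have diff: "(r i - r (i + 1))\<^sup>2 \<le> e / 100"
    using e2 e by (simp add: power2_eq_square)
  have "2 * (r i)\<^sup>2 + 2 * (r (i + 1))\<^sup>2 = (r i + r (i + 1))\<^sup>2 + (r i - r (i + 1))\<^sup>2"
    by (simp add: power2_eq_square algebra_simps)
  then have "2 * (r i)\<^sup>2 + 2 * (r (i + 1))\<^sup>2 \<le> 1 + 202/100 * e" using sum diff by linarith
  moreover have "1 - e / 2 \<le> cos (\<phi> i)" "1 - e / 2 \<le> cos (\<phi> (i + 1))"
    using small_ang by (auto intro!: cosge \<phi>_bounds)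
  ultimately have "C \<ge> 1/4 - e"
    using noether_\<phi>[of i] noether_\<phi>[of "i + 1"] e by linarith
  then show ?thesis by (simp add: e_def)
qed

text \<open>
  The upper bound holds at every vertex because no cosine exceeds \<open>1\<close>; the lower bound is the
  upper bound at the neighbour together with the triangle inequality.
\<close>

lemma radius_near_half:
  assumes C: "C \<ge> 1/4 - \<epsilon>\<^sup>2"
  shows "\<bar>r i - 1/2\<bar> \<le> \<epsilon>\<^sup>2"
proof -
  have up: "r k \<le> 1/2 + \<epsilon>\<^sup>2" for k
  proof (rule power2_le_imp_le)
    have "(r k)\<^sup>2 \<le> 1/4 + \<epsilon>\<^sup>2" using noether_\<phi>[of k] cos_le_one[of "\<phi> k"] C by linarith
    also have "\<dots> \<le> (1/2 + \<epsilon>\<^sup>2)\<^sup>2"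
      using zero_le_square[of "\<epsilon> * \<epsilon>"] by (simp add: power2_eq_square algebra_simps)
    finally show "(r k)\<^sup>2 \<le> (1/2 + \<epsilon>\<^sup>2)\<^sup>2" .
  qed simp
  show ?thesis using up[of i] up[of "i + 1"] r_sum_ge[of i] by (simp add: abs_le_iff)
qed

text \<open>
  Once \<open>r i\<close> and \<open>C\<close> are at least \<open>1/2\<close> and \<open>1/4\<close> up to \<open>\<epsilon>\<^sup>2\<close>, the Noether relation leaves no room for the
  cosine to be far from \<open>1\<close>. The constant \<open>10\<close> covers the marked vertex, where \<open>\<gamma>\<close> is twice the
  angle in the relation.
\<close>

lemma all_angles_small:
  assumes eps: "0 \<le> \<epsilon>" "\<epsilon> \<le> 1/10" and C: "C \<ge> 1/4 - \<epsilon>\<^sup>2"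
  shows "\<gamma> i \<le> 10 * \<epsilon>"
proof -
  have "1/2 - \<epsilon>\<^sup>2 \<le> r i" using radius_near_half[OF C, of i] by (simp add: abs_le_iff)
  moreover have "\<epsilon>\<^sup>2 \<le> 1/100" using power_mono[OF eps(2,1), of 2] by (simp add: power2_eq_square)
  ultimately have "(1/2 - \<epsilon>\<^sup>2)\<^sup>2 \<le> (r i)\<^sup>2" by (intro power_mono) auto
  moreover have "1/4 - \<epsilon>\<^sup>2 \<le> (1/2 - \<epsilon>\<^sup>2)\<^sup>2"
    using zero_le_square[of "\<epsilon> * \<epsilon>"] by (simp add: power2_eq_square algebra_simps)
  ultimately have "1 - 4 * \<epsilon>\<^sup>2 \<le> cos (\<phi> i)" using noether_\<phi>[of i] C by linarith
  then have "\<phi> i \<le> 4 * \<epsilon>"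
    using \<phi>_bounds[of i] \<gamma>_le_pi[of i] eps by (intro cos_le_near_one_imp) auto
  then show ?thesis using \<phi>_bounds[of i] eps by linarith
qed

end

section \<open>The perturbed recurrence of the deficits\<close>

text \<open>
  The regime in which all expansions are made, with \<open>E\<close> a common bound for the vertex angles.
\<close>

locale small_noether_cycle = noether_cycle +
  fixes E :: real
  assumes E_bounds: "0 \<le> E" "E \<le> 1"
    and \<gamma>_le_E: "\<gamma> i \<le> E"
    and r_near: "\<bar>r i - 1/2\<bar> \<le> E\<^sup>2 / 100"
begin

lemma E_powers: "0 \<le> E\<^sup>2" "E\<^sup>2 \<le> 1" "E ^ 4 = E\<^sup>2 * E\<^sup>2" "E ^ 3 = E\<^sup>2 * E" "0 \<le> E ^ 4"
  using E_bounds by (simp_all add: power_le_one power2_eq_square power3_eq_cube power4_eq_xxxx mult_le_one)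

lemma angles_le_E: "\<alpha> i \<le> E" "\<beta> i \<le> E" "\<phi> i \<le> E" "\<eta> i \<le> 2 * E"
  using \<alpha>_le[of i] \<beta>_le[of i] \<phi>_bounds(2)[of i] \<gamma>_le_E[of i] \<gamma>_le_E[of "i + 1"] \<eta>_eq[of i]
  by auto

text \<open>
  The two evaluations of \<open>(r i)\<^sup>2 + (r (i + 1))\<^sup>2\<close>. In the law of cosines the factor
  \<open>r i * r (i + 1)\<close> may be replaced by \<open>1/4\<close>, since it multiplies \<open>1 - cos (\<eta> i) = O(E\<^sup>2)\<close>, and
  \<open>(r i - r (i + 1))\<^sup>2\<close> is already of fourth order.
\<close>

lemma pair_equation:
  "\<bar>2 * (\<eta> i)\<^sup>2 + 4 * (\<phi> i)\<^sup>2 + 4 * (\<phi> (i + 1))\<^sup>2 - (8 - 32 * C)\<bar> \<le> 32 * E ^ 4"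
proof -
  define x where "x = r i - 1/2"
  define y where "y = r (i + 1) - 1/2"
  define p where "p = r i * r (i + 1)"
  define h where "h = 1 - cos (\<eta> i)"
  have r_eq: "r i = x + 1/2" "r (i + 1) = y + 1/2" by (simp_all add: x_def y_def)
  have xy: "\<bar>x\<bar> \<le> E\<^sup>2 / 100" "\<bar>y\<bar> \<le> E\<^sup>2 / 100" using r_near by (auto simp: x_def y_def)
  have "\<bar>x * y\<bar> \<le> E\<^sup>2 / 100 * 1"
    unfolding abs_mult using xy E_powers by (intro mult_mono) auto
  moreover have "p - 1/4 = x * y + x / 2 + y / 2"
    unfolding p_def r_eq by (simp add: field_simps)
  ultimately have p: "\<bar>p - 1/4\<bar> \<le> E\<^sup>2 / 10" using xy E_powers by linarith
  have p1: "\<bar>p\<bar> \<le> 1" using p E_powers by linarith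
  have d: "\<bar>r i - r (i + 1)\<bar> \<le> E\<^sup>2 / 4" by (intro radius_diff_le angles_le_E)
  have "\<bar>r i - r (i + 1)\<bar>\<^sup>2 \<le> (E\<^sup>2 / 4)\<^sup>2" using d by (intro power_mono) auto
  then have d2: "(r i - r (i + 1))\<^sup>2 \<le> E ^ 4 / 16"
    by (simp add: power_divide power_mult[symmetric])
  have \<eta>2: "(\<eta> i)\<^sup>2 \<le> 4 * E\<^sup>2"
    using power_mono[OF angles_le_E(4) \<eta>_nonneg, of i 2] by (simp add: power_mult_distrib)
  have \<eta>4: "(\<eta> i) ^ 4 \<le> 16 * E ^ 4"
    using power_mono[OF angles_le_E(4) \<eta>_nonneg, of i 4] by (simp add: power_mult_distrib)
  have h: "\<bar>h - (\<eta> i)\<^sup>2 / 2\<bar> \<le> 2/3 * E ^ 4"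
    using cos_quadratic_approx[of "\<eta> i"] \<eta>4 unfolding h_def by linarith
  have "\<bar>p * (h - (\<eta> i)\<^sup>2 / 2)\<bar> \<le> 1 * (2/3 * E ^ 4)"
    unfolding abs_mult using p1 h by (intro mult_mono) auto
  moreover have "\<bar>(p - 1/4) * (\<eta> i)\<^sup>2\<bar> \<le> (E\<^sup>2 / 10) * (4 * E\<^sup>2)"
    unfolding abs_mult using p \<eta>2 E_powers by (intro mult_mono) auto
  moreover have "p * h - (\<eta> i)\<^sup>2 / 8 = p * (h - (\<eta> i)\<^sup>2 / 2) + (p - 1/4) * (\<eta> i)\<^sup>2 / 2"
    by (simp add: field_simps)
  ultimately have ph: "\<bar>p * h - (\<eta> i)\<^sup>2 / 8\<bar> \<le> 13/15 * E ^ 4"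
    using E_powers(3) by linarith
  have loc: "(r i)\<^sup>2 + (r (i + 1))\<^sup>2 = 1/2 + p * h + (r i - r (i + 1))\<^sup>2 / 2"
    using law_of_cosines[of i] by (simp add: p_def h_def power2_eq_square field_simps)
  have cg: "\<bar>cos (\<phi> k) - (1 - (\<phi> k)\<^sup>2 / 2)\<bar> \<le> E ^ 4 / 24" for k
    using cos_quadratic_approx[of "\<phi> k"] power_mono[OF angles_le_E(3) \<phi>_bounds(1), of k 4] by linarith
  have "\<bar>(\<eta> i)\<^sup>2 / 8 + (\<phi> i)\<^sup>2 / 4 + (\<phi> (i + 1))\<^sup>2 / 4 - (1/2 - 2 * C)\<bar> \<le> 2 * E ^ 4"
    using noether_\<phi>[of i] noether_\<phi>[of "i + 1"] cg[of i] cg[of "i + 1"] loc ph d2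
      zero_le_power2[of "r i - r (i + 1)"] E_powers(5) by linarith
  then show ?thesis by linarith
qed

text \<open>
  By the law of sines the relative difference of \<open>sin (\<alpha> i)\<close> and \<open>sin (\<beta> i)\<close> is that of the radii,
  of order \<open>E\<^sup>2\<close>; the sines themselves are of order \<open>E\<close>.
\<close>

lemma base_angle_diff: "\<bar>\<alpha> i - \<beta> i\<bar> \<le> 2 * E ^ 3"
proof -
  have d: "\<bar>r i - r (i + 1)\<bar> \<le> E\<^sup>2 / 4" by (intro radius_diff_le angles_le_E)
  have "1/4 \<le> r i" using r_near[of i] E_powers by linarith
  then have "1/4 * \<bar>sin (\<alpha> i) - sin (\<beta> i)\<bar> \<le> \<bar>r i * (sin (\<alpha> i) - sin (\<beta> i))\<bar>"
    unfolding abs_mult by (intro mult_right_mono) auto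
  also have "r i * (sin (\<alpha> i) - sin (\<beta> i)) = (r (i + 1) - r i) * sin (\<beta> i)"
    using base_height[of i] by (simp add: algebra_simps)
  also have "\<bar>\<dots>\<bar> \<le> E\<^sup>2 / 4 * E"
  proof -
    have "\<bar>sin (\<beta> i)\<bar> \<le> E"
      using abs_sin_x_le_abs_x[of "\<beta> i"] \<beta>_nonneg[of i] angles_le_E(2)[of i] by linarith
    then show ?thesis
      unfolding abs_mult using d by (intro mult_mono) (auto simp: abs_minus_commute)
  qed
  also have "E\<^sup>2 / 4 * E = E ^ 3 / 4" by (simp add: E_powers(4))
  finally have "\<bar>sin (\<alpha> i) - sin (\<beta> i)\<bar> \<le> E ^ 3"
    by simp
  moreover have "\<bar>\<alpha> i - \<beta> i\<bar> \<le> 2 * \<bar>sin (\<alpha> i) - sin (\<beta> i)\<bar>"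
    using \<alpha>_nonneg[of i] \<beta>_nonneg[of i] angles_le_E(1,2)[of i] E_bounds by (intro sin_diff_lower) auto
  ultimately show ?thesis
    by (meson mult_left_mono order_trans zero_le_numeral)
qed

lemma square_close:
  assumes "\<bar>u - v\<bar> \<le> 4 * E ^ 3" "0 \<le> u" "0 \<le> v" "u \<le> 2 * E" "v \<le> 4 * E"
  shows "\<bar>u\<^sup>2 - v\<^sup>2\<bar> \<le> 24 * E ^ 4"
proof -
  have "\<bar>u\<^sup>2 - v\<^sup>2\<bar> = \<bar>u - v\<bar> * \<bar>u + v\<bar>"
    by (simp add: power2_eq_square algebra_simps flip: abs_mult)
  also have "\<dots> \<le> (4 * E ^ 3) * (6 * E)"
    using assms E_bounds by (intro mult_mono) auto
  finally show ?thesis by (simp add: eval_nat_numeral mult_ac)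
qed

lemma vertex_angle_square:
  assumes "\<not> int N dvd i"
  shows "\<bar>4 * (\<phi> i)\<^sup>2 - (\<eta> (i - 1) + \<eta> i)\<^sup>2\<bar> \<le> 24 * E ^ 4"
proof -
  have \<phi>: "\<phi> i = \<gamma> i" using assms by (simp add: \<phi>_def)
  have "2 * \<gamma> i - (\<eta> (i - 1) + \<eta> i) = (\<alpha> i - \<beta> i) - (\<alpha> (i - 1) - \<beta> (i - 1))"
    by (simp add: \<gamma>_eq \<eta>_eq)
  then have "\<bar>2 * \<gamma> i - (\<eta> (i - 1) + \<eta> i)\<bar> \<le> 4 * E ^ 3"
    using base_angle_diff[of i] base_angle_diff[of "i - 1"] by linarith
  then have "\<bar>(2 * \<gamma> i)\<^sup>2 - (\<eta> (i - 1) + \<eta> i)\<^sup>2\<bar> \<le> 24 * E ^ 4"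
    using \<gamma>_nonneg[of i] \<eta>_nonneg[of i] \<eta>_nonneg[of "i - 1"] \<gamma>_le_E[of i]
      angles_le_E(4)[of i] angles_le_E(4)[of "i - 1"]
    by (intro square_close) auto
  then show ?thesis by (simp add: \<phi> power_mult_distrib)
qed

text \<open>
  By symmetry the two base angles at the marked vertex coincide, so half of its angle is \<open>\<alpha> 0\<close>,
  nearly half of \<open>\<eta> 0\<close>.
\<close>

lemma marked_angle_square: "\<bar>4 * (\<phi> 0)\<^sup>2 - (\<eta> 0)\<^sup>2\<bar> \<le> 24 * E ^ 4"
proof -
  have "\<gamma> 0 = 2 * \<alpha> 0" using \<gamma>_eq[of 0] \<beta>_reflected[of 0] by simp
  then have \<phi>: "\<phi> 0 = \<alpha> 0" by (simp add: \<phi>_def)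
  have "\<bar>2 * \<alpha> 0 - \<eta> 0\<bar> \<le> 4 * E ^ 3"
    using base_angle_diff[of 0] E_bounds(1) by (simp add: \<eta>_eq)
  then have "\<bar>(2 * \<alpha> 0)\<^sup>2 - (\<eta> 0)\<^sup>2\<bar> \<le> 24 * E ^ 4"
    using \<alpha>_nonneg[of 0] \<eta>_nonneg[of 0] angles_le_E(1,4)[of 0] E_bounds(1)
    by (intro square_close) auto
  then show ?thesis by (simp add: \<phi> power_mult_distrib)
qed

lemma deficit_orbit_form:
  assumes N: "N = 2 * m - 1" "m \<ge> 2" and j: "j < m"
  shows "\<bar>orbit_form (\<lambda>k. \<eta> (int k)) j - (8 - 32 * C)\<bar> \<le> 80 * E ^ 4"
proof -
  \<comment> \<open>The marked vertex recurs only at multiples of \<open>N = 2 * m - 1 > m\<close>.\<close>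
  have nd: "\<not> int N dvd int k" if "0 < k" "k \<le> m" for k
  proof -
    have "\<not> N dvd k" using that N by (auto dest: dvd_imp_le)
    then show ?thesis by simp
  qed
  show ?thesis
  proof (cases j)
    case 0
    have "orbit_form (\<lambda>k. \<eta> (int k)) 0 = 3 * (\<eta> 0)\<^sup>2 + (\<eta> 0 + \<eta> 1)\<^sup>2"
      by (simp add: orbit_form_def)
    then show ?thesis
      using pair_equation[of 0] marked_angle_square vertex_angle_square[of 1] nd[of 1] N 0
      by (simp add: abs_le_iff)
  next
    case (Suc l)
    have "orbit_form (\<lambda>k. \<eta> (int k)) j =
        (\<eta> (int j - 1) + \<eta> (int j))\<^sup>2 + (\<eta> (int j) + \<eta> (int j + 1))\<^sup>2 + 2 * (\<eta> (int j))\<^sup>2"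
      by (simp add: orbit_form_def Suc add.commute)
    moreover have "\<not> int N dvd int j + 1" using nd[of "j + 1"] j by (simp add: add.commute)
    ultimately show ?thesis
      using pair_equation[of "int j"] vertex_angle_square[of "int j"]
        vertex_angle_square[of "int j + 1"] nd[of j] j Suc
      by (simp add: abs_le_iff)
  qed
qed

end

context noether_cycle
begin

text \<open>
  Here \<open>120 = 10 * 12\<close> combines the pigeonhole bound with the loss in \<open>all_angles_small\<close>.
\<close>

lemma small_noether_cycle_of_large:
  assumes N: "N \<ge> 120"
  shows "small_noether_cycle N C r \<alpha> \<beta> \<eta> \<gamma> (120 / N)"
proof -
  define \<epsilon> where "\<epsilon> = 12 / real N"
  have eps: "0 \<le> \<epsilon>" "\<epsilon> \<le> 1/10" using N by (auto simp: \<epsilon>_def field_simps)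
  obtain i where "\<gamma> i + \<gamma> (i + 1) \<le> \<epsilon>" using ex_small_angles by (auto simp: \<epsilon>_def)
  then have "\<gamma> i \<le> \<epsilon>" "\<gamma> (i + 1) \<le> \<epsilon>" using \<gamma>_nonneg[of i] \<gamma>_nonneg[of "i + 1"] by linarith+
  then have C: "C \<ge> 1/4 - \<epsilon>\<^sup>2" using eps by (intro C_lower)
  show ?thesis
  proof
    show "\<gamma> i \<le> 120 / real N" for i using all_angles_small[OF eps C, of i] by (simp add: \<epsilon>_def)
    show "\<bar>r i - 1/2\<bar> \<le> (120 / real N)\<^sup>2 / 100" for i
      using radius_near_half[OF C, of i] by (simp add: \<epsilon>_def power_divide)
  qed (use N in auto)
qed

lemma \<eta>_reflected: "\<eta> (- i - 1) = \<eta> i"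
  using \<beta>_reflected[of i] \<beta>_reflected[of "- i - 1"] by (simp add: \<eta>_eq)

lemma \<eta>_reversed: "\<eta> (int N - 1 - i) = \<eta> i"
  using \<eta>_reflected[of i] \<eta>_periodic[of "- i - 1"] by (simp add: algebra_simps)

lemma half_cycle_sum:
  assumes "N = 2 * m - 1" "m \<ge> 1"
  shows "2 * (\<Sum>j<m. \<eta> (int j)) - \<eta> (int (m - 1)) = pi"
proof -
  have Nm: "N = m + (m - 1)" using assms by simp
  have "(\<Sum>j<m - 1. \<eta> (int (m + j))) = (\<Sum>j<m - 1. \<eta> (int j))"
  proof (rule sum.reindex_bij_witness[where i = "\<lambda>j. m - 2 - j" and j = "\<lambda>j. m - 2 - j"])
    fix j assume "j \<in> {..<m - 1}"
    then show "\<eta> (int (m - 2 - j)) = \<eta> (int (m + j))"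
      using \<eta>_reversed[of "int (m + j)"] assms by (simp add: of_nat_diff algebra_simps)
  qed auto
  moreover have "pi = (\<Sum>j<m. \<eta> (int j)) + (\<Sum>j<m - 1. \<eta> (int (m + j)))"
  proof -
    have "(\<Sum>j<m + k. f j) = (\<Sum>j<m. f j) + (\<Sum>j<k. f (m + j))" for k and f :: "nat \<Rightarrow> real"
      by (induction k) simp_all
    from this[of "\<lambda>j. \<eta> (int j)" "m - 1"] show ?thesis using \<eta>_sum Nm by simp
  qed
  moreover have "(\<Sum>j<m. \<eta> (int j)) = (\<Sum>j<m - 1. \<eta> (int j)) + \<eta> (int (m - 1))"
    using assms(2) by (cases m) auto
  ultimately show ?thesis by simp
qed

text \<open>
  The scale is \<open>a = sqrt ((8 - 32 * C) / 10)\<close>. It must not be much smaller than \<open>1/N\<close>, or the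
  errors of order \<open>N\<^sup>-\<^sup>4\<close> would not be small relative to \<open>a\<^sup>2\<close>; an edge with deficit at least the
  mean \<open>\<pi> / N\<close> prevents this. The numbers come from \<open>E = 120 / N\<close>: the residual is at most
  \<open>80 * E\<^sup>4 / a\<^sup>2\<close> with \<open>a\<^sup>2 \<ge> 1 / (2 * N\<^sup>2)\<close>, and \<open>N \<ge> 100000\<close> makes \<open>32 * E\<^sup>4\<close> negligible
  against \<open>1 / N\<^sup>2\<close>.
\<close>

lemma deficits_near_scaled_orbit:
  assumes N: "N = 2 * m - 1" "N \<ge> 100000"
  obtains a where "0 < a" "a \<le> 500 / N"
    "\<And>j. j < m \<Longrightarrow> \<bar>orbit_form (\<lambda>k. \<eta> (int k) / a) j - 10\<bar> \<le> 40000000000 / (real N)\<^sup>2"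
proof -
  define E where "E = 120 / real N"
  interpret small_noether_cycle N C r \<alpha> \<beta> \<eta> \<gamma> E
    unfolding E_def using N by (intro small_noether_cycle_of_large) auto
  have m: "m \<ge> 2" using N by simp
  define t where "t = 1 / (real N)\<^sup>2"
  have N0: "real N > 0" using N by simp
  have t: "0 < t" "t \<le> 1 / 10000000000"
  proof -
    show "0 < t" using N0 by (simp add: t_def)
    have "(100000::real)\<^sup>2 \<le> (real N)\<^sup>2" using N(2) by (intro power_mono) auto
    then show "t \<le> 1 / 10000000000" unfolding t_def by (intro divide_left_mono) (use N0 in auto)
  qed
  have E2: "E\<^sup>2 = 14400 * t" by (simp add: E_def t_def power_divide)
  have E4: "E ^ 4 = 207360000 * (t * t)" using E2 E_powers(3) by simp
  have tt: "t * t \<le> t / 10000000000" using mult_left_mono[OF t(2), of t] t(1) by simp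
  define a where "a = sqrt ((8 - 32 * C) / 10)"
  obtain i where i: "\<eta> i \<ge> pi / N" using ex_large_deficit by blast
  have "4 * t = (2 / N)\<^sup>2" by (simp add: t_def power_divide)
  also have "\<dots> \<le> (\<eta> i)\<^sup>2"
  proof (rule power_mono)
    have "2 / real N \<le> pi / N" using pi_ge_two by (intro divide_right_mono) auto
    then show "2 / real N \<le> \<eta> i" using i by linarith
  qed simp
  finally have lower: "4 * t \<le> (\<eta> i)\<^sup>2" .
  have low: "8 - 32 * C \<ge> 5 * t"
    using pair_equation[of i] lower E4 tt t zero_le_power2[of "\<phi> i"] zero_le_power2[of "\<phi> (i + 1)"]
    unfolding abs_le_iff by linarith
  then have C0: "8 - 32 * C > 0" using t by linarith
  have a2: "a\<^sup>2 = (8 - 32 * C) / 10" using C0 by (simp add: a_def)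
  have a0: "a > 0" using C0 by (simp add: a_def)
  have sq: "(\<eta> i)\<^sup>2 \<le> 4 * E\<^sup>2" "(\<phi> i)\<^sup>2 \<le> E\<^sup>2" "(\<phi> (i + 1))\<^sup>2 \<le> E\<^sup>2"
    using power_mono[OF angles_le_E(4) \<eta>_nonneg, of i 2] power_mono[OF angles_le_E(3) \<phi>_bounds(1), of _ 2]
    by (auto simp: power_mult_distrib)
  have "8 - 32 * C \<le> 2500000 * t"
    using pair_equation[of i] sq E2 E4 tt t unfolding abs_le_iff by linarith
  then have "a\<^sup>2 \<le> (500 / N)\<^sup>2" by (simp add: a2 t_def power_divide)
  then have aN: "a \<le> 500 / N" using N0 by (intro power2_le_imp_le[of a]) auto
  have "\<bar>orbit_form (\<lambda>k. \<eta> (int k) / a) j - 10\<bar> \<le> 40000000000 * t" if "j < m" for j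
  proof -
    define Q where "Q = orbit_form (\<lambda>k. \<eta> (int k)) j"
    have Q: "\<bar>Q - 10 * a\<^sup>2\<bar> \<le> 80 * E ^ 4"
      using deficit_orbit_form[OF N(1) m that] by (simp add: Q_def a2 diff_divide_distrib)
    have "orbit_form (\<lambda>k. \<eta> (int k) / a) j = Q / a\<^sup>2"
      using orbit_form_scale[of "1 / a" "\<lambda>k. \<eta> (int k)" j] by (simp add: Q_def power_divide)
    then have "a\<^sup>2 * (orbit_form (\<lambda>k. \<eta> (int k) / a) j - 10) = Q - 10 * a\<^sup>2"
      using a0 by (simp add: field_simps)
    moreover have "a\<^sup>2 * \<bar>orbit_form (\<lambda>k. \<eta> (int k) / a) j - 10\<bar> =
        \<bar>a\<^sup>2 * (orbit_form (\<lambda>k. \<eta> (int k) / a) j - 10)\<bar>"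
      by (simp add: abs_mult)
    ultimately have "a\<^sup>2 * \<bar>orbit_form (\<lambda>k. \<eta> (int k) / a) j - 10\<bar> = \<bar>Q - 10 * a\<^sup>2\<bar>"
      by (simp only:)
    also have "\<dots> \<le> (t / 2) * (40000000000 * t)" using Q E4 t by simp
    also have "\<dots> \<le> a\<^sup>2 * (40000000000 * t)"
      using low t by (intro mult_right_mono) (auto simp: a2)
    finally show ?thesis using a0 by (simp add: mult_le_cancel_left)
  qed
  then show ?thesis using that[OF a0 aN] by (simp add: t_def)
qed

end

section \<open>Determination of the scale and the asymptotics\<close>

lemma lambda_s_bounds: "0 < \<bar>lambda_s\<bar>" "\<bar>lambda_s\<bar> \<le> 1/2"
proof -
  have "2 < sqrt 5" "sqrt 5 < (3::real)" by (auto intro: real_less_rsqrt real_less_lsqrt)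
  then show "0 < \<bar>lambda_s\<bar>" "\<bar>lambda_s\<bar> \<le> 1/2" by (auto simp: lambda_s_def)
qed

text \<open>
  For a positive comparison sequence the finitely many exceptional terms can be absorbed into the
  constant.
\<close>

lemma bigo_sequence_bound:
  fixes f g :: "nat \<Rightarrow> real"
  assumes fg: "f \<in> O(g)" and g: "\<And>j. g j > 0"
  obtains B where "B > 0" "\<And>j. \<bar>f j\<bar> \<le> B * g j"
proof -
  obtain b where b: "b > 0" "eventually (\<lambda>j. norm (f j) \<le> b * norm (g j)) sequentially"
    using fg by (elim landau_o.bigE) auto
  then obtain J where J: "\<And>j. j \<ge> J \<Longrightarrow> \<bar>f j\<bar> \<le> b * g j"
    using g by (auto simp: eventually_sequentially abs_of_pos)
  define s where "s = (\<Sum>i<J. \<bar>f i\<bar> / g i)"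
  have s0: "s \<ge> 0" unfolding s_def using g by (intro sum_nonneg divide_nonneg_nonneg) (auto intro: less_imp_le)
  have "\<bar>f j\<bar> \<le> (b + s) * g j" for j
  proof (cases "j \<ge> J")
    case True
    have "b * g j \<le> (b + s) * g j" using s0 g[of j] by (intro mult_right_mono) auto
    then show ?thesis using J[OF True] by linarith
  next
    case False
    have "\<bar>f j\<bar> / g j \<le> s"
      unfolding s_def using False g
      by (intro member_le_sum[of j "{..<J}" "\<lambda>i. \<bar>f i\<bar> / g i"]) (auto intro: divide_nonneg_pos)
    then have "\<bar>f j\<bar> / g j \<le> b + s" using b(1) by linarith
    then show ?thesis using g[of j] by (simp add: pos_divide_le_eq)
  qed
  then show ?thesis using that[of "b + s"] b(1) s0 by simp
qed

text \<open>
  The quotient \<open>(N + 1) / (N + M)\<close> converges as \<open>N\<close> grows, hence is bounded; at a possible zero of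
  \<open>N + M\<close> it is \<open>0\<close>.
\<close>

lemma inverse_shift_bound:
  fixes M :: real
  obtains D where "D > 0" "\<And>N :: nat. \<bar>1 / (real N + M)\<bar> \<le> D / (real N + 1)"
proof -
  have "filterlim (\<lambda>N :: nat. M + real N) at_top sequentially"
    by (intro filterlim_tendsto_add_at_top[OF tendsto_const] filterlim_real_sequentially)
  then have "(\<lambda>N :: nat. (1 - M) / (M + real N)) \<longlonglongrightarrow> 0"
    by (intro real_tendsto_divide_at_top[OF tendsto_const])
  then have "Bseq (\<lambda>N :: nat. (1 - M) / (M + real N))"
    by (intro convergent_imp_Bseq) (auto simp: convergent_def)
  then obtain D where D: "D > 0" "\<And>N. norm ((1 - M) / (M + real N)) \<le> D"
    by (auto elim: BseqE)
  have "\<bar>1 / (real N + M)\<bar> \<le> (1 + D) / (real N + 1)" for N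
  proof (cases "real N + M = 0")
    case False
    then have "(real N + 1) * (1 / (real N + M)) = 1 + (1 - M) / (M + real N)"
      by (simp add: field_simps)
    then have "\<bar>(real N + 1) * (1 / (real N + M))\<bar> \<le> 1 + D"
      using D(2)[of N] unfolding real_norm_def by linarith
    then have "\<bar>1 / (real N + M)\<bar> * (real N + 1) \<le> 1 + D"
      unfolding abs_mult by (simp add: mult.commute)
    then show ?thesis by (simp add: pos_le_divide_eq)
  qed (use D in simp)
  moreover have "1 + D > 0" using D(1) by simp
  ultimately show ?thesis using that by blast
qed

lemma positive_limit_lower_bound:
  fixes w :: "nat \<Rightarrow> real"
  assumes lim: "w \<longlonglongrightarrow> L" and "L > 0" and pos: "\<And>j. w j > 0"
  obtains \<omega> where "\<omega> > 0" "\<And>j. w j \<ge> \<omega>"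
proof -
  have "(\<lambda>j. inverse (w j)) \<longlonglongrightarrow> inverse L" using assms by (intro tendsto_inverse) auto
  then have "Bseq (\<lambda>j. inverse (w j))"
    by (intro convergent_imp_Bseq) (auto simp: convergent_def)
  then obtain D where D: "D > 0" "\<And>j. norm (inverse (w j)) \<le> D" by (auto elim: BseqE)
  have "w j \<ge> inverse D" for j
  proof -
    have "inverse (w j) \<le> D" using D(2)[of j] pos[of j] by simp
    then have "inverse D \<le> inverse (inverse (w j))" using pos[of j] by (intro le_imp_inverse_le) auto
    then show ?thesis by simp
  qed
  then show ?thesis using that[of "inverse D"] D(1) by simp
qed

lemma M_star_partial_sum:
  assumes "\<And>j. \<bar>w j - 1\<bar> \<le> A * (1/2) ^ j"
  shows "\<bar>M_star w - 2 * (\<Sum>j<m. w j - 1)\<bar> \<le> 4 * A * (1/2) ^ m"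
proof -
  have g: "(\<lambda>j. A * (1/2) ^ (j + m)) sums (A * (1/2) ^ m * (1 / (1 - 1/2)))" for m
    using sums_mult[OF geometric_sums[of "1/2 :: real"], of "A * (1/2) ^ m"]
    by (simp add: power_add mult_ac)
  have tail: "summable (\<lambda>j. A * (1/2) ^ (j + k))" for k
    using g[of k] by (rule sums_summable)
  have s: "summable (\<lambda>j. w j - 1)"
  proof (rule summable_comparison_test'[where N = 0])
    show "summable (\<lambda>j. A * (1/2) ^ j)" using tail[of 0] by simp
    show "norm (w j - 1) \<le> A * (1/2) ^ j" for j using assms[of j] by simp
  qed
  have "(\<Sum>j. w j - 1) = (\<Sum>j. w (j + m) - 1) + (\<Sum>j<m. w j - 1)"
    by (rule suminf_split_initial_segment[OF s])
  moreover have "norm (\<Sum>j. w (j + m) - 1) \<le> (\<Sum>j. A * (1/2) ^ (j + m))"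
  proof (rule norm_suminf_le[OF _ tail])
    show "norm (w (j + m) - 1) \<le> A * (1/2) ^ (j + m)" for j using assms[of "j + m"] by simp
  qed
  moreover have "(\<Sum>j. A * (1/2) ^ (j + m)) = 2 * A * (1/2) ^ m"
    using sums_unique[OF g[of m]] by simp
  ultimately show ?thesis by (simp add: M_star_def abs_mult)
qed

text \<open>
  Comparison with \<open>w\<close> gives \<open>\<eta>\<^sub>j = a * (w\<^sub>j + O(\<sigma>))\<close> with \<open>\<sigma> = N\<^sup>-\<^sup>2 + 2\<^sup>-\<^sup>m\<close>. Summing over the cycle,
  \<open>\<pi> / a\<close> differs from \<open>N + M\<close> by \<open>O(N * \<sigma>)\<close>: the \<open>w\<^sub>j\<close> along the cycle add up to \<open>N + M\<close> except
  for a geometric tail. This is a relative error \<open>O(\<sigma>)\<close> in \<open>a\<close>, the same order as the pointwise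
  error, so both contribute \<open>O(\<sigma> / N)\<close> to the deficits.
\<close>

lemma (in noether_cycle) deficit_near_orbit:
  fixes w :: "nat \<Rightarrow> real" and A \<omega> :: real
  defines "K1 \<equiv> (40000000000 + 60 * A) / (2 * \<omega>)"
  assumes Qw: "\<And>j. orbit_form w j = 10" and \<omega>: "\<omega> > 0" "\<And>j. w j \<ge> \<omega>"
    and A: "\<And>j. \<bar>w j - 1\<bar> \<le> A * (1/2) ^ j"
    and N: "N = 2 * m - 1" "N \<ge> 100000" and NM: "real N \<ge> 2 * \<bar>M_star w\<bar>" and j: "j < m"
  shows "\<bar>\<eta> (int j) - pi * w j / (real N + M_star w)\<bar>
    \<le> 500 * (K1 + 2 * (1 + A) * (2 * K1 + 6 * A)) * (1 / real N ^ 3 + (1/2) ^ m / real N)"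
proof -
  define h where "h = (1/2 :: real) ^ m"
  define \<sigma> where "\<sigma> = 1 / (real N)\<^sup>2 + h"
  define S where "S = real N + M_star w"
  define K2 where "K2 = 2 * K1 + 6 * A"
  have N0: "real N \<ge> 100000" using N by simp
  have m: "m \<ge> 2" using N by simp
  have A0: "A \<ge> 0" using A[of 0] by simp
  have h0: "h \<ge> 0" "h \<le> \<sigma>" by (auto simp: h_def \<sigma>_def)
  have K10: "K1 \<ge> 0" using A0 \<omega> by (simp add: K1_def)
  have \<sigma>0: "\<sigma> \<ge> 0" using h0 by linarith
  have K20: "K2 \<ge> 0" using K10 A0 by (simp add: K2_def)
  obtain a where a: "0 < a" "a \<le> 500 / N"
    "\<And>j. j < m \<Longrightarrow> \<bar>orbit_form (\<lambda>k. \<eta> (int k) / a) j - 10\<bar> \<le> 40000000000 / (real N)\<^sup>2"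
    using deficits_near_scaled_orbit[OF N] by blast
  define x where "x k = \<eta> (int k) / a" for k
  have "\<bar>w m - w (m - 2)\<bar> \<le> A * (1/2) ^ m + A * (1/2) ^ (m - 2)"
    using A[of m] A[of "m - 2"] by linarith
  also have "(1/2 :: real) ^ (m - 2) = 4 * (1/2) ^ m"
  proof -
    obtain l where "m = l + 2" using m by (metis add.commute le_Suc_ex)
    then show ?thesis by simp
  qed
  finally have wend: "\<bar>w m - w (m - 2)\<bar> \<le> 5 * (A * h)" by (simp add: h_def)
  have xw: "\<bar>x k - w k\<bar> \<le> K1 * \<sigma>" if "k < m" for k
  proof -
    have "(100000::real)\<^sup>2 \<le> (real N)\<^sup>2" using N0 by (intro power_mono) auto
    then have \<rho>: "40000000000 / (real N)\<^sup>2 \<le> 8" using N0 by (simp add: field_simps)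
    have "x m = x (m - 2)"
      using \<eta>_reversed[of "int m"] N m by (simp add: x_def of_nat_diff algebra_simps)
    then have "\<bar>x k - w k\<bar> \<le> (40000000000 / (real N)\<^sup>2 + 12 * \<bar>w m - w (m - 2)\<bar>) / (2 * \<omega>)"
      using a(1,3) \<eta>_nonneg that
      by (intro orbit_comparison[OF m _ \<omega>(2,1) Qw _ \<rho>]) (auto simp: x_def)
    also have "\<dots> \<le> ((40000000000 + 60 * A) * \<sigma>) / (2 * \<omega>)"
    proof (intro divide_right_mono)
      define \<tau> where "\<tau> = \<bar>w m - w (m - 2)\<bar>"
      have "A * h \<le> A * \<sigma>" using h0 A0 by (intro mult_left_mono) auto
      then show "40000000000 / (real N)\<^sup>2 + 12 * \<bar>w m - w (m - 2)\<bar> \<le> (40000000000 + 60 * A) * \<sigma>"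
      proof -
        have "(40000000000 + 60 * A) * \<sigma> = 40000000000 / (real N)\<^sup>2 + 40000000000 * h + 60 * (A * \<sigma>)"
          by (simp add: distrib_right) (simp add: \<sigma>_def distrib_left)
        moreover have "\<tau> \<le> 5 * (A * h)" using wend by (simp add: \<tau>_def)
        ultimately show ?thesis using h0(1) \<open>A * h \<le> A * \<sigma>\<close> unfolding \<tau>_def[symmetric] by linarith
      qed
    qed (use \<omega> in auto)
    finally show ?thesis by (simp add: K1_def)
  qed
  have "\<bar>pi / a - S\<bar> \<le> K2 * (N * \<sigma>)"
  proof -
    \<comment> \<open>The middle edge \<open>m - 1\<close> is its own mirror image and must be counted once.\<close>
    have "pi / a = 2 * (\<Sum>k<m. x k) - x (m - 1)"
      using half_cycle_sum[OF N(1)] m a(1)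
      by (simp add: x_def sum_divide_distrib[symmetric] field_simps)
    also have "\<dots> = 2 * (\<Sum>k<m. x k - w k) - (x (m - 1) - w (m - 1)) + 2 * (\<Sum>k<m. w k - 1)
        + 2 * real m - w (m - 1)"
      by (simp add: sum_subtractf algebra_simps)
    finally have eq: "pi / a - S = 2 * (\<Sum>k<m. x k - w k) - (x (m - 1) - w (m - 1))
        - (w (m - 1) - 1) - (M_star w - 2 * (\<Sum>k<m. w k - 1))"
      using N m by (simp add: S_def of_nat_diff)
    have "\<bar>\<Sum>k<m. x k - w k\<bar> \<le> (\<Sum>k<m. \<bar>x k - w k\<bar>)" by (rule sum_abs)
    also have "\<dots> \<le> (\<Sum>k<m. K1 * \<sigma>)" by (intro sum_mono xw) auto
    finally have e1: "\<bar>\<Sum>k<m. x k - w k\<bar> \<le> real m * (K1 * \<sigma>)" by simp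
    have e2: "\<bar>x (m - 1) - w (m - 1)\<bar> \<le> K1 * \<sigma>" using m by (intro xw) auto
    have e3: "\<bar>w (m - 1) - 1\<bar> \<le> 2 * (A * h)"
      using A[of "m - 1"] m by (cases m) (auto simp: h_def)
    have e4: "\<bar>M_star w - 2 * (\<Sum>k<m. w k - 1)\<bar> \<le> 4 * (A * h)"
      using M_star_partial_sum[OF A, of m] by (simp add: h_def)
    have "\<bar>pi / a - S\<bar> \<le> 2 * (real m * (K1 * \<sigma>)) + K1 * \<sigma> + 6 * (A * h)"
      unfolding eq using e1 e2 e3 e4 by linarith
    also have "\<dots> = (2 * real m + 1) * (K1 * \<sigma>) + 6 * (A * h)" by (simp add: algebra_simps)
    also have "\<dots> \<le> (2 * real N) * (K1 * \<sigma>) + 6 * (A * (real N * \<sigma>))"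
    proof (intro add_mono mult_left_mono mult_right_mono)
      show "2 * real m + 1 \<le> 2 * real N" using N m by (simp add: of_nat_diff)
      have "1 * \<sigma> \<le> real N * \<sigma>" using N0 \<sigma>0 by (intro mult_right_mono) auto
      then show "h \<le> real N * \<sigma>" using h0 by linarith
    qed (use K10 \<sigma>0 A0 in auto)
    finally show ?thesis by (simp add: K2_def algebra_simps)
  qed
  then have piS: "\<bar>S - pi / a\<bar> \<le> K2 * (N * \<sigma>)" by (simp add: abs_minus_commute)
  have S: "S \<ge> real N / 2" "S > 0" using NM N0 by (auto simp: S_def)
  have wA: "\<bar>w j\<bar> \<le> 1 + A"
  proof -
    have "A * (1/2) ^ j \<le> A * 1" using A0 by (intro mult_left_mono) (auto simp: power_le_one)
    then show ?thesis using A[of j] by linarith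
  qed
  have SS: "\<bar>(S - pi / a) / S\<bar> \<le> 2 * K2 * \<sigma>"
  proof -
    have "\<bar>S - pi / a\<bar> \<le> (2 * K2 * \<sigma>) * (real N / 2)" using piS by (simp add: algebra_simps)
    also have "\<dots> \<le> (2 * K2 * \<sigma>) * S" using S K20 \<sigma>0 by (intro mult_left_mono) auto
    finally show ?thesis using S by (simp add: abs_divide field_simps)
  qed
  have "\<eta> (int j) - pi * w j / S = a * ((x j - w j) + w j * ((S - pi / a) / S))"
    using a(1) S(2) by (simp add: x_def field_simps)
  also have "\<bar>\<dots>\<bar> \<le> a * (K1 * \<sigma> + (1 + A) * (2 * K2 * \<sigma>))"
  proof -
    have "\<bar>w j * ((S - pi / a) / S)\<bar> \<le> (1 + A) * (2 * K2 * \<sigma>)"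
      unfolding abs_mult using wA SS A0 by (intro mult_mono) auto
    then have "\<bar>(x j - w j) + w j * ((S - pi / a) / S)\<bar> \<le> K1 * \<sigma> + (1 + A) * (2 * K2 * \<sigma>)"
      using xw[OF j] by linarith
    then show ?thesis using a(1) by (simp add: abs_mult)
  qed
  also have "\<dots> \<le> 500 / N * (K1 * \<sigma> + (1 + A) * (2 * K2 * \<sigma>))"
    using a(2) K10 K20 \<sigma>0 A0 by (intro mult_right_mono) auto
  also have "\<dots> = 500 * (K1 + 2 * (1 + A) * K2) * (\<sigma> / N)" by (simp add: algebra_simps)
  also have "\<sigma> / N = 1 / real N ^ 3 + (1/2) ^ m / real N"
    by (simp add: \<sigma>_def h_def add_divide_distrib power2_eq_square power3_eq_cube)
  finally show ?thesis by (simp add: S_def K2_def)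
qed

lemma (in noether_cycle) deficit_le_pi:
  assumes "j < N"
  shows "\<eta> (int j) \<le> pi"
  unfolding \<eta>_sum[symmetric] using assms \<eta>_nonneg
  by (intro member_le_sum[of j "{..<N}" "\<lambda>i. \<eta> (int i)"]) auto

text \<open>
  The expansions leave out finitely many \<open>N\<close>; for these the left-hand side is bounded and
  \<open>1 / (N + 1) ^ 3\<close> is bounded below, so a larger constant suffices. The bound on \<open>w\<^sub>j - 1\<close> with rate \<open>1/2\<close> is weaker than the
  true rate \<open>\<bar>\<lambda>\<^sub>s\<bar>\<close>; it accounts for the term \<open>2\<^sup>-\<^sup>m\<close>.
\<close>

lemma deficit_asymptotics:
  assumes orbit: "limiting_orbit w" and A: "\<And>j. \<bar>w j - 1\<bar> \<le> A * (1/2) ^ j"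
  obtains K where "K \<ge> 0"
    "\<And>N C r \<alpha> \<beta> \<eta> \<gamma> m j. noether_cycle N C r \<alpha> \<beta> \<eta> \<gamma> \<Longrightarrow> N = 2 * m - 1 \<Longrightarrow> N \<ge> 2 \<Longrightarrow> j < m \<Longrightarrow>
      \<bar>\<eta> (int j) - pi * w j / (real N + M_star w)\<bar>
        \<le> K * (1 / real (N + 1) ^ 3 + (1/2) ^ m / real (N + 1))"
proof -
  have A0: "A \<ge> 0" using A[of 0] by simp
  obtain \<omega> where \<omega>: "\<omega> > 0" "\<And>j. w j \<ge> \<omega>"
    using orbit positive_limit_lower_bound[of w 1] by (auto simp: limiting_orbit_def)
  obtain D where D: "D > 0" "\<And>N :: nat. \<bar>1 / (real N + M_star w)\<bar> \<le> D / (real N + 1)"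
    using inverse_shift_bound by blast
  define K1 where "K1 = (40000000000 + 60 * A) / (2 * \<omega>)"
  define K where "K = 500 * (K1 + 2 * (1 + A) * (2 * K1 + 6 * A))"
  define N1 where "N1 = max 100000 (nat \<lceil>2 * \<bar>M_star w\<bar>\<rceil>)"
  define L where "L = pi + pi * (1 + A) * D"
  define K' where "K' = 8 * K + L * real (N1 + 1) ^ 3"
  have "K1 \<ge> 0" using A0 \<omega> by (simp add: K1_def)
  then have K0: "K \<ge> 0" using A0 by (simp add: K_def)
  have L0: "L \<ge> 0" using A0 D by (simp add: L_def)
  have K'0: "K' \<ge> 0" "8 * K \<le> K'" "L * real (N1 + 1) ^ 3 \<le> K'" using K0 L0 by (auto simp: K'_def)
  show ?thesis
  proof (rule that[OF K'0(1)])
    fix N C r \<alpha> \<beta> \<eta> \<gamma> m j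
    assume cyc: "noether_cycle N C r \<alpha> \<beta> \<eta> \<gamma>" and N: "N = 2 * m - 1" "N \<ge> 2" and j: "j < m"
    interpret noether_cycle N C r \<alpha> \<beta> \<eta> \<gamma> by (fact cyc)
    let ?err = "\<bar>\<eta> (int j) - pi * w j / (real N + M_star w)\<bar>"
    let ?n = "real (N + 1)"
    show "?err \<le> K' * (1 / ?n ^ 3 + (1/2) ^ m / ?n)"
    proof (cases "N \<ge> N1")
      case True
      have "real N \<ge> 2 * \<bar>M_star w\<bar>" using True by (simp add: N1_def ceiling_le_iff nat_le_iff)
      then have "?err \<le> K * (1 / real N ^ 3 + (1/2) ^ m / real N)"
        unfolding K_def K1_def using True N j
        by (intro deficit_near_orbit[OF orbit_form_limiting_orbit[OF orbit] \<omega> A]) (auto simp: N1_def)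
      also have "\<dots> \<le> K * (8 * (1 / ?n ^ 3 + (1/2) ^ m / ?n))"
      proof (intro mult_left_mono K0)
        have half: "1 / real N \<le> 2 / ?n" using N by (simp add: field_simps)
        have "(1 / real N) ^ 3 \<le> (2 / ?n) ^ 3" using half by (intro power_mono) auto
        then have "1 / real N ^ 3 \<le> 8 * (1 / ?n ^ 3)" by (simp add: power_divide)
        moreover have "(1/2) ^ m / real N \<le> 2 * ((1/2) ^ m / ?n)"
          using mult_left_mono[OF half, of "(1/2) ^ m"] by (simp add: mult.commute)
        moreover have "0 \<le> (1/2) ^ m / ?n" by simp
        ultimately show "1 / real N ^ 3 + (1/2) ^ m / real N \<le> 8 * (1 / ?n ^ 3 + (1/2) ^ m / ?n)"
          unfolding distrib_left by linarith
      qed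
      also have "\<dots> = (8 * K) * (1 / ?n ^ 3 + (1/2) ^ m / ?n)" by (simp only: mult_ac)
      also have "\<dots> \<le> K' * (1 / ?n ^ 3 + (1/2) ^ m / ?n)"
        by (intro mult_right_mono K'0(2)) auto
      finally show ?thesis .
    next
      case False
      have "A * (1/2) ^ j \<le> A * 1" using A0 by (intro mult_left_mono) (auto simp: power_le_one)
      then have wA: "\<bar>w j\<bar> \<le> 1 + A" using A[of j] by linarith
      have "D / (real N + 1) \<le> D / 1" using D(1) by (intro divide_left_mono) auto
      then have DN: "\<bar>1 / (real N + M_star w)\<bar> \<le> D" using D(2)[of N] by linarith
      have "\<bar>pi * w j / (real N + M_star w)\<bar> = pi * \<bar>w j\<bar> * \<bar>1 / (real N + M_star w)\<bar>"
        by (simp add: abs_mult abs_divide)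
      also have "\<dots> \<le> pi * (1 + A) * D" using wA DN A0 by (intro mult_mono) auto
      finally have "\<bar>pi * w j / (real N + M_star w)\<bar> \<le> pi * (1 + A) * D" .
      moreover have "\<eta> (int j) \<le> pi" using deficit_le_pi[of j] j N by simp
      ultimately have "?err \<le> L"
        using \<eta>_nonneg[of "int j"] unfolding L_def by linarith
      also have "\<dots> \<le> L * real (N1 + 1) ^ 3 * (1 / ?n ^ 3)"
      proof -
        have "?n ^ 3 \<le> real (N1 + 1) ^ 3" using False by (intro power_mono) auto
        then have "L * ?n ^ 3 \<le> L * real (N1 + 1) ^ 3" using L0 by (intro mult_left_mono) auto
        then have "L \<le> L * real (N1 + 1) ^ 3 / ?n ^ 3" by (subst pos_le_divide_eq) auto
        then show ?thesis by simp
      qed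
      also have "\<dots> \<le> K' * (1 / ?n ^ 3 + (1/2) ^ m / ?n)"
        using K'0 by (intro mult_mono) auto
      finally show ?thesis .
    qed
  qed
qed

theorem theorem1p2:
  fixes w :: "nat \<Rightarrow> real" and c :: real
  assumes orbit: "limiting_orbit w"
    and c_nonzero: "c \<noteq> 0"
    and c_asymp: "(\<lambda>j. w j - 1 - c * lambda_s ^ j) \<in> O(\<lambda>j. \<bar>lambda_s\<bar> ^ (2 * j))"
  shows "(\<exists>K. \<forall>n m N p v q ctr C j.
            n = 2 * m \<longrightarrow> n \<ge> 8 \<longrightarrow> N = n - 1 \<longrightarrow>
            max_area_small_polygon n p \<longrightarrow>
            maximizer_structure N (p ` {..<n}) v q ctr C \<longrightarrow>
            j < m \<longrightarrow>
            \<bar>central_deficit v ctr (int j) - pi * w j / (real N + M_star w)\<bar>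
              \<le> K * (1 / real n ^ 3 + 2 powr (- real n / 2) / real n))
       \<and> (\<exists>K. \<forall>n m N p v q ctr C j.
            n = 2 * m \<longrightarrow> n \<ge> 8 \<longrightarrow> N = n - 1 \<longrightarrow>
            max_area_small_polygon n p \<longrightarrow>
            maximizer_structure N (p ` {..<n}) v q ctr C \<longrightarrow>
            j < m \<longrightarrow>
            \<bar>central_deficit v ctr (int j) - pi / (real N + M_star w)
                - pi * c / (real N + M_star w) * lambda_s ^ j\<bar>
              \<le> K * (\<bar>lambda_s\<bar> ^ (2 * j) / real n
                     + 1 / real n ^ 3 + 2 powr (- real n / 2) / real n))"
proof -
  obtain B where B: "B > 0" "\<And>j. \<bar>w j - 1 - c * lambda_s ^ j\<bar> \<le> B * \<bar>lambda_s\<bar> ^ (2 * j)"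
    using bigo_sequence_bound[OF c_asymp] lambda_s_bounds(1) by auto
  have A: "\<bar>w j - 1\<bar> \<le> (\<bar>c\<bar> + B) * (1/2) ^ j" for j
  proof -
    have l: "\<bar>lambda_s\<bar> ^ j \<le> (1/2) ^ j" using lambda_s_bounds by (intro power_mono) auto
    have "\<bar>lambda_s\<bar> ^ (2 * j) \<le> \<bar>lambda_s\<bar> ^ j"
      using lambda_s_bounds by (intro power_decreasing) auto
    with l have "\<bar>lambda_s\<bar> ^ (2 * j) \<le> (1/2) ^ j" by linarith
    then have "B * \<bar>lambda_s\<bar> ^ (2 * j) \<le> B * (1/2) ^ j" using B(1) by (intro mult_left_mono) auto
    moreover have "\<bar>c * lambda_s ^ j\<bar> \<le> \<bar>c\<bar> * (1/2) ^ j"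
      using l by (simp add: abs_mult power_abs mult_left_mono)
    ultimately show ?thesis using B(2)[of j] by (simp add: algebra_simps abs_le_iff)
  qed
  obtain K where K: "K \<ge> 0"
    "\<And>N C r \<alpha> \<beta> \<eta> \<gamma> m j. noether_cycle N C r \<alpha> \<beta> \<eta> \<gamma> \<Longrightarrow> N = 2 * m - 1 \<Longrightarrow> N \<ge> 2 \<Longrightarrow> j < m \<Longrightarrow>
      \<bar>\<eta> (int j) - pi * w j / (real N + M_star w)\<bar>
        \<le> K * (1 / real (N + 1) ^ 3 + (1/2) ^ m / real (N + 1))"
    using deficit_asymptotics[OF orbit A] by blast
  obtain D where D: "D > 0" "\<And>N :: nat. \<bar>1 / (real N + M_star w)\<bar> \<le> D / (real N + 1)"
    using inverse_shift_bound by blast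
  have first: "\<bar>central_deficit v ctr (int j) - pi * w j / (real N + M_star w)\<bar>
        \<le> K * (1 / real n ^ 3 + 2 powr (- real n / 2) / real n)"
    if "n = 2 * m" "n \<ge> 8" "N = n - 1" "maximizer_structure N V v q ctr C" "j < m"
    for n m N V v q ctr C j
  proof -
    have "2 powr (- real n / 2) = (1/2) ^ m"
      using that(1) by (simp add: powr_minus powr_realpow power_one_over inverse_eq_divide)
    moreover have "N + 1 = n" "N > 0" using that by auto
    ultimately show ?thesis
      using K(2)[OF noether_cycle_of_maximizer[OF that(4)], of m j] that by auto
  qed
  have second: "\<bar>central_deficit v ctr (int j) - pi / (real N + M_star w)
          - pi * c / (real N + M_star w) * lambda_s ^ j\<bar>
        \<le> (K + pi * D * B) * (\<bar>lambda_s\<bar> ^ (2 * j) / real n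
            + 1 / real n ^ 3 + 2 powr (- real n / 2) / real n)"
    if H: "n = 2 * m" "n \<ge> 8" "N = n - 1" "maximizer_structure N V v q ctr C" "j < m"
    for n m N V v q ctr C j
  proof -
    define S where "S = real N + M_star w"
    define P where "P = \<bar>lambda_s\<bar> ^ (2 * j) / real n"
    define Q where "Q = 1 / real n ^ 3 + 2 powr (- real n / 2) / real n"
    have n: "real N + 1 = real n" using H by simp
    have PQ: "P \<ge> 0" "Q \<ge> 0" by (auto simp: P_def Q_def)
    have "\<bar>pi * (w j - 1 - c * lambda_s ^ j) * (1 / S)\<bar>
        \<le> pi * (B * \<bar>lambda_s\<bar> ^ (2 * j)) * (D / real n)"
      unfolding abs_mult using B D D(2)[of N] n by (intro mult_mono) (auto simp: S_def)
    also have "\<dots> = pi * D * B * P" by (simp add: P_def)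
    finally have e2: "\<bar>pi * (w j - 1 - c * lambda_s ^ j) * (1 / S)\<bar> \<le> pi * D * B * P" .
    have e1: "\<bar>central_deficit v ctr (int j) - pi * w j / S\<bar> \<le> K * Q"
      using first[OF H] by (simp add: S_def Q_def)
    have "central_deficit v ctr (int j) - pi / S - pi * c / S * lambda_s ^ j
        = (central_deficit v ctr (int j) - pi * w j / S) + pi * (w j - 1 - c * lambda_s ^ j) * (1 / S)"
      by (simp add: diff_divide_distrib right_diff_distrib)
    then have "\<bar>central_deficit v ctr (int j) - pi / S - pi * c / S * lambda_s ^ j\<bar>
        \<le> K * Q + pi * D * B * P" using e1 e2 by linarith
    also have "\<dots> \<le> K * (P + Q) + pi * D * B * (P + Q)"
      using PQ K(1) D(1) B(1) by (intro add_mono mult_left_mono) auto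
    also have "\<dots> = (K + pi * D * B) * (P + Q)" by (simp add: algebra_simps)
    finally show ?thesis by (simp add: S_def P_def Q_def add.assoc)
  qed
  show ?thesis
    by (rule conjI, rule exI[of _ K], intro allI impI, rule first, assumption+,
        rule exI[of _ "K + pi * D * B"], intro allI impI, rule second, assumption+)
qed

end
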